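(* Assume (H1), (H2), (H3). Let $w\in H^{-1}(\Omega)$ and let $u\in H_0^1(\Omega)$ satisfy $$\int_\Omega j_\xi(x,u,\nabla u)\cdot\nabla z+\int_\Omega j_s(x,u,\nabla u)z=\langle w,z\rangle\qquad\forall z\in V_u.\tag{$\ast$}$$ Suppose that $j_\xi(x,u,\nabla u)\cdot\nabla u\in L^1(\Omega)$ and that there exist $v\in H_0^1(\Omega)\cap L^\infty(\Omega)$ and $\eta\in L^1(\Omega)$ with $j_s(x,u,\nabla u)v+j_\xi(x,u,\nabla u)\cdot\nabla v\ge\eta$ a.e. Then $j_\xi(x,u,\nabla u)\cdot\nabla v+j_s(x,u,\nabla u)v\in L^1(\Omega)$ and $$\int_\Omega j_\xi(x,u,\nabla u)\cdot\nabla v+\int_\Omega j_s(x,u,\nabla u)v=\langle w,v\rangle.$$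
   Context: $\Omega\subset\mathbb{R}^N$ bounded open, $N\ge3$. $j:\Omega\times\mathbb{R}\times\mathbb{R}^N\to\mathbb{R}$ measurable in $x$, $C^1$ in $(s,\xi)$ for a.e. $x$, partial derivatives $j_s,j_\xi$. (H1) $\xi\mapsto j(x,s,\xi)$ strictly convex; (H2) $\alpha_0|\xi|^2\le j(x,s,\xi)\le\alpha(|s|)|\xi|^2$ ($\alpha_0>0$, $\alpha$ positive increasing continuous); (H3) $|j_s(x,s,\xi)|\le\beta(|s|)|\xi|^2$ ($\beta$ positive increasing continuous). $V_u=\{z\in H_0^1(\Omega)\cap L^\infty(\Omega): u\in L^\infty(\{x: z(x)\ne0\})\}$. $\langle\cdot,\cdot\rangle$ is the $H^{-1}$–$H_0^1$ duality. *)

theory Defs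
  imports "HOL-Analysis.Analysis"
begin

definition pderiv_dir :: "('a::euclidean_space \<Rightarrow> real) \<Rightarrow> 'a \<Rightarrow> 'a \<Rightarrow> real" where
  "pderiv_dir f i x = frechet_derivative f (at x) i"

definition cgrad :: "('a::euclidean_space \<Rightarrow> real) \<Rightarrow> 'a \<Rightarrow> 'a" where
  "cgrad f x = (\<Sum>i\<in>Basis. pderiv_dir f i x *\<^sub>R i)"

coinductive smooth_fun :: "('a::euclidean_space \<Rightarrow> real) \<Rightarrow> bool" where
  "continuous_on UNIV f \<Longrightarrow> f differentiable_on UNIV \<Longrightarrow>
   (\<forall>i\<in>Basis. smooth_fun (pderiv_dir f i)) \<Longrightarrow> smooth_fun f"

definition test_fun :: "'a::euclidean_space set \<Rightarrow> ('a \<Rightarrow> real) \<Rightarrow> bool" where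
  "test_fun \<Omega> \<phi> \<longleftrightarrow> smooth_fun \<phi> \<and> compact (closure {x. \<phi> x \<noteq> 0})
     \<and> closure {x. \<phi> x \<noteq> 0} \<subseteq> \<Omega>"

definition L2 :: "'a::euclidean_space set \<Rightarrow> ('a \<Rightarrow> 'b::euclidean_space) \<Rightarrow> bool" where
  "L2 \<Omega> f \<longleftrightarrow> f \<in> borel_measurable (lebesgue_on \<Omega>)
     \<and> integrable (lebesgue_on \<Omega>) (\<lambda>x. (norm (f x))\<^sup>2)"

definition Linfty :: "'a::euclidean_space set \<Rightarrow> ('a \<Rightarrow> real) \<Rightarrow> bool" where
  "Linfty \<Omega> f \<longleftrightarrow> f \<in> borel_measurable (lebesgue_on \<Omega>)
     \<and> (\<exists>C. AE x in lebesgue_on \<Omega>. \<bar>f x\<bar> \<le> C)"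

definition weak_grad :: "'a::euclidean_space set \<Rightarrow> ('a \<Rightarrow> real) \<Rightarrow> ('a \<Rightarrow> 'a) \<Rightarrow> bool" where
  "weak_grad \<Omega> u g \<longleftrightarrow> (\<forall>\<phi> i. test_fun \<Omega> \<phi> \<and> i \<in> Basis \<longrightarrow>
      integrable (lebesgue_on \<Omega>) (\<lambda>x. u x * pderiv_dir \<phi> i x)
    \<and> integrable (lebesgue_on \<Omega>) (\<lambda>x. (g x \<bullet> i) * \<phi> x)
    \<and> (\<integral>x. u x * pderiv_dir \<phi> i x \<partial>lebesgue_on \<Omega>)
        = - (\<integral>x. (g x \<bullet> i) * \<phi> x \<partial>lebesgue_on \<Omega>))"

definition H1_dist2 :: "'a::euclidean_space set \<Rightarrow> ('a \<Rightarrow> real) \<Rightarrow> ('a \<Rightarrow> 'a)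
     \<Rightarrow> ('a \<Rightarrow> real) \<Rightarrow> ('a \<Rightarrow> 'a) \<Rightarrow> real" where
  "H1_dist2 \<Omega> u g v h = (\<integral>x. (u x - v x)\<^sup>2 \<partial>lebesgue_on \<Omega>)
      + (\<integral>x. (norm (g x - h x))\<^sup>2 \<partial>lebesgue_on \<Omega>)"

definition H01 :: "'a::euclidean_space set \<Rightarrow> ('a \<Rightarrow> real) \<Rightarrow> ('a \<Rightarrow> 'a) \<Rightarrow> bool" where
  "H01 \<Omega> u g \<longleftrightarrow> L2 \<Omega> u \<and> L2 \<Omega> g \<and> weak_grad \<Omega> u g \<and>
     (\<exists>\<phi>::nat \<Rightarrow> 'a \<Rightarrow> real. (\<forall>k. test_fun \<Omega> (\<phi> k)) \<and>
        (\<lambda>k. H1_dist2 \<Omega> (\<phi> k) (cgrad (\<phi> k)) u g) \<longlonglongrightarrow> 0)"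

text \<open>H^{-1}(Omega): linear functionals on H_0^1(Omega) bounded in the H1 norm;
  the duality pairing is application.\<close>
definition Hminus1 :: "'a::euclidean_space set \<Rightarrow> (('a \<Rightarrow> real) \<Rightarrow> real) \<Rightarrow> bool" where
  "Hminus1 \<Omega> w \<longleftrightarrow>
     (\<forall>u g v h a b. H01 \<Omega> u g \<and> H01 \<Omega> v h \<longrightarrow>
        w (\<lambda>x. a * u x + b * v x) = a * w u + b * w v)
   \<and> (\<exists>C. \<forall>u g. H01 \<Omega> u g \<longrightarrow> \<bar>w u\<bar> \<le> C * sqrt (H1_dist2 \<Omega> u g (\<lambda>_. 0) (\<lambda>_. 0)))"

definition in_V :: "'a::euclidean_space set \<Rightarrow> ('a \<Rightarrow> real) \<Rightarrow> ('a \<Rightarrow> real) \<Rightarrow> ('a \<Rightarrow> 'a) \<Rightarrow> bool" where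
  "in_V \<Omega> u z gz \<longleftrightarrow> H01 \<Omega> z gz \<and> Linfty \<Omega> z \<and>
     (\<exists>C. AE x in lebesgue_on \<Omega>. z x \<noteq> 0 \<longrightarrow> \<bar>u x\<bar> \<le> C)"

definition strictly_convex :: "('a::real_vector \<Rightarrow> real) \<Rightarrow> bool" where
  "strictly_convex f \<longleftrightarrow> (\<forall>x y t. x \<noteq> y \<and> 0 < t \<and> t < 1 \<longrightarrow>
     f ((1 - t) *\<^sub>R x + t *\<^sub>R y) < (1 - t) * f x + t * f y)"

end

theory Submission
  imports Defs
begin

text \<open>
  The equation is tested with \<open>z\<^sub>k = c(u/k) v\<close>, where \<open>c\<close> is a \<open>C\<^sup>1\<close> bump function with \<open>c(0) = 1\<close>
  supported in \<open>[-1,1]\<close>. Its gradient is \<open>c(u/k) \<nabla>v + k\<^sup>-\<^sup>1 c'(u/k) v \<nabla>u\<close>, so with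
  \<open>f = j\<^sub>\<xi> \<cdot> \<nabla>v + j\<^sub>s v\<close> the equation reads
  \<open>\<integral> c(u/k) f + k\<^sup>-\<^sup>1 \<integral> c'(u/k) v j\<^sub>\<xi> \<cdot> \<nabla>u = \<langle>w, z\<^sub>k\<rangle>\<close>. The second term vanishes as \<open>k\<close> grows because
  \<open>j\<^sub>\<xi> \<cdot> \<nabla>u\<close> is integrable and \<open>v\<close> is bounded, and the right-hand side tends to \<open>\<langle>w, v\<rangle>\<close> because
  \<open>z\<^sub>k \<rightarrow> v\<close> in \<open>H\<^sup>1\<close>. Fatou's lemma with the minorant \<open>\<eta>\<close> gives integrability of \<open>f\<close>, and then dominated
  convergence identifies the limit of the first term. The analytic work is to show \<open>z\<^sub>k \<in> H\<^sub>0\<^sup>1\<close>.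
\<close>

subsection \<open>Smooth functions and test functions\<close>

text \<open>The equation only admits test functions off whose zero set \<open>u\<close> is bounded,
  and \<open>v\<close> need not be one. This forces a cut-off in \<open>u\<close> rather than in
  \<open>x\<close>, and the price is a gradient term along \<open>Du\<close>, which the
  integrability of \<open>jxi x (u x) (Du x) \<bullet> Du x\<close> absorbs. The lower bound
  concerns only the sum \<open>f\<close>, so its two summands are estimated together throughout.
  Membership in \<open>H01\<close> means approximation by functions that are smooth in the
  coinductive sense, while the cut-off is only C^1. Polynomials bridge this gap: a polynomial in a
  test function stays in the algebra it generates with the constants, and on the bounded range of
  that test function Weierstrass approximation is accurate together with the first derivative. Thus
  neither mollification nor a chain rule for general smooth outer functions enters. Since the
  cut-off equals 1 at 0, its composition with a test function has no compact support; compactness of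
  the support comes from the factor that approximates \<open>v\<close>.\<close>

lemma pderiv_dir_eq:
  assumes "(f has_derivative D) (at x)"
  shows "pderiv_dir f i x = D i"
  using frechet_derivative_at[OF assms] by (simp add: pderiv_dir_def)

lemma pderiv_dir_const: "pderiv_dir (\<lambda>x. c) i = (\<lambda>x. 0)"
  by (rule ext, rule pderiv_dir_eq) (rule has_derivative_const)

lemma pderiv_dir_add:
  assumes "f differentiable_on UNIV" "g differentiable_on UNIV"
  shows "pderiv_dir (\<lambda>x. f x + g x) i = (\<lambda>x. pderiv_dir f i x + pderiv_dir g i x)"
proof
  fix x
  have "(f has_derivative frechet_derivative f (at x)) (at x)"
    "(g has_derivative frechet_derivative g (at x)) (at x)"
    using assms by (auto simp: differentiable_on_def frechet_derivative_works)
  from has_derivative_add[OF this]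
  show "pderiv_dir (\<lambda>x. f x + g x) i x = pderiv_dir f i x + pderiv_dir g i x"
    by (subst pderiv_dir_eq) (auto simp: pderiv_dir_def)
qed

lemma pderiv_dir_mult:
  assumes "f differentiable_on UNIV" "g differentiable_on UNIV"
  shows "pderiv_dir (\<lambda>x. f x * g x) i = (\<lambda>x. f x * pderiv_dir g i x + pderiv_dir f i x * g x)"
proof
  fix x
  have "(f has_derivative frechet_derivative f (at x)) (at x)"
    "(g has_derivative frechet_derivative g (at x)) (at x)"
    using assms by (auto simp: differentiable_on_def frechet_derivative_works)
  from has_derivative_mult[OF this]
  show "pderiv_dir (\<lambda>x. f x * g x) i x = f x * pderiv_dir g i x + pderiv_dir f i x * g x"
    by (subst pderiv_dir_eq) (auto simp: pderiv_dir_def)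
qed

text \<open>Constants get their own rule because their smoothness is itself a coinductive fact; it
  falls out of the same argument as sums and products.\<close>

inductive smooth_alg :: "('a::euclidean_space \<Rightarrow> real) \<Rightarrow> bool" where
  base: "smooth_fun f \<Longrightarrow> smooth_alg f"
| const: "smooth_alg (\<lambda>x. c)"
| add: "smooth_alg f \<Longrightarrow> smooth_alg g \<Longrightarrow> smooth_alg (\<lambda>x. f x + g x)"
| mult: "smooth_alg f \<Longrightarrow> smooth_alg g \<Longrightarrow> smooth_alg (\<lambda>x. f x * g x)"

lemma smooth_funD:
  assumes "smooth_fun f"
  shows "continuous_on UNIV f" "f differentiable_on UNIV" "i \<in> Basis \<Longrightarrow> smooth_fun (pderiv_dir f i)"
  using assms by (auto elim: smooth_fun.cases)

lemma smooth_algD: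
  assumes "smooth_alg f"
  shows "continuous_on UNIV f \<and> f differentiable_on UNIV \<and> (\<forall>i\<in>Basis. smooth_alg (pderiv_dir f i))"
  using assms
proof induction
  case (base f)
  then show ?case by (auto intro: smooth_alg.base smooth_funD)
next
  case (const c)
  then show ?case by (auto simp: pderiv_dir_const intro: smooth_alg.const)
next
  case (add f g)
  then show ?case
    by (auto simp: pderiv_dir_add intro!: continuous_intros smooth_alg.add)
next
  case (mult f g)
  then show ?case
    by (auto simp: pderiv_dir_mult intro!: continuous_intros smooth_alg.add smooth_alg.mult)
qed

text \<open>Coinduction up to sums and products: derivatives of a product leave the class of products, but
  not the generated algebra.\<close>
lemma smooth_alg_imp_smooth_fun: "smooth_alg f \<Longrightarrow> smooth_fun f"
  by (coinduction arbitrary: f rule: smooth_fun.coinduct) (use smooth_algD in blast)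

lemma smooth_fun_const: "smooth_fun (\<lambda>x. c)"
  and smooth_fun_add: "smooth_fun f \<Longrightarrow> smooth_fun g \<Longrightarrow> smooth_fun (\<lambda>x. f x + g x)"
  and smooth_fun_mult: "smooth_fun f \<Longrightarrow> smooth_fun g \<Longrightarrow> smooth_fun (\<lambda>x. f x * g x)"
  by (auto intro!: smooth_alg_imp_smooth_fun intro: smooth_alg.intros)

text \<open>A polynomial in \<open>f\<close> is built from \<open>f\<close> and constants by sums
  and products, so the closure properties replace a chain rule with higher derivatives.\<close>

lemma smooth_fun_polynomial_compose:
  fixes p :: "real \<Rightarrow> real"
  assumes "real_polynomial_function p" "smooth_fun f"
  shows "smooth_fun (\<lambda>x. p (f x))"
  using assms(1)
proof induction
  case (linear h)
  have "h = (\<lambda>x. h 1 * x)"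
    using linear
    by (metis bounded_linear.linear linear_cmul mult.commute mult.right_neutral real_scaleR_def)
  then have "(\<lambda>x. h (f x)) = (\<lambda>x. h 1 * f x)" by metis
  then show ?case
    using smooth_fun_mult[OF smooth_fun_const assms(2)] by metis
qed (auto intro: smooth_fun_const smooth_fun_add smooth_fun_mult)

lemma cgrad_inner_Basis: "i \<in> Basis \<Longrightarrow> cgrad f x \<bullet> i = pderiv_dir f i x"
  by (simp add: cgrad_def)

lemma has_derivative_cgrad:
  assumes "f differentiable (at x)"
  shows "(f has_derivative (\<lambda>h. cgrad f x \<bullet> h)) (at x)"
proof -
  have D: "(f has_derivative frechet_derivative f (at x)) (at x)"
    using assms by (simp add: frechet_derivative_works)
  then have "linear (frechet_derivative f (at x))"
    using has_derivative_linear by blast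
  then have "frechet_derivative f (at x) h = cgrad f x \<bullet> h" for h
    by (subst (1) euclidean_representation[symmetric, of h])
      (simp add: linear_sum linear_cmul cgrad_def inner_sum_left inner_sum_right inner_commute pderiv_dir_def mult.commute)
  then show ?thesis using D by (metis (no_types, lifting) ext)
qed

lemma cgrad_eqI:
  assumes "(f has_derivative (\<lambda>h. a \<bullet> h)) (at x)"
  shows "cgrad f x = a"
  by (simp add: cgrad_def pderiv_dir_eq[OF assms] euclidean_representation)

lemma test_funD:
  assumes "test_fun \<Omega> f"
  shows "smooth_fun f" "continuous_on UNIV f" "f differentiable (at x)"
    "(f has_derivative (\<lambda>h. cgrad f x \<bullet> h)) (at x)"
    "compact (closure {x. f x \<noteq> 0})" "closure {x. f x \<noteq> 0} \<subseteq> \<Omega>"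
    "x \<notin> closure {x. f x \<noteq> 0} \<Longrightarrow> f x = 0"
    "x \<notin> \<Omega> \<Longrightarrow> f x = 0"
proof -
  show "smooth_fun f" "compact (closure {x. f x \<noteq> 0})" and s: "closure {x. f x \<noteq> 0} \<subseteq> \<Omega>"
    using assms by (auto simp: test_fun_def)
  then show "continuous_on UNIV f" and d: "f differentiable (at x)"
    using smooth_funD(1,2)[of f] by (auto simp: differentiable_on_def)
  show "(f has_derivative (\<lambda>h. cgrad f x \<bullet> h)) (at x)"
    by (rule has_derivative_cgrad[OF d])
  show *: "x \<notin> closure {x. f x \<noteq> 0} \<Longrightarrow> f x = 0"
    using closure_subset[of "{x. f x \<noteq> 0}"] by auto
  then show "x \<notin> \<Omega> \<Longrightarrow> f x = 0" using s by blast
qed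

text \<open>The inclusion is into the closure because a partial derivative can be nonzero at a point
  where \<open>f\<close> vanishes, for instance at a change of sign.\<close>

lemma test_fun_subset:
  assumes "smooth_fun g" "test_fun \<Omega> f" "{x. g x \<noteq> 0} \<subseteq> closure {x. f x \<noteq> 0}"
  shows "test_fun \<Omega> g"
proof -
  have "closure {x. g x \<noteq> 0} \<subseteq> closure {x. f x \<noteq> 0}"
    using assms(3) by (simp add: closure_minimal)
  moreover from this have "compact (closure {x. g x \<noteq> 0})"
    using test_funD(5)[OF assms(2)] bounded_subset unfolding compact_eq_bounded_closed by blast
  ultimately show ?thesis
    using assms(1) test_funD(6)[OF assms(2)] unfolding test_fun_def by blast
qed

lemma test_fun_mult:
  assumes "smooth_fun g" "test_fun \<Omega> f"
  shows "test_fun \<Omega> (\<lambda>x. g x * f x)"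
proof (rule test_fun_subset[OF _ assms(2)])
  show "smooth_fun (\<lambda>x. g x * f x)"
    by (rule smooth_fun_mult[OF assms(1) test_funD(1)[OF assms(2)]])
  show "{x. g x * f x \<noteq> 0} \<subseteq> closure {x. f x \<noteq> 0}"
    using closure_subset[of "{x. f x \<noteq> 0}"] by auto
qed

lemma test_fun_add:
  assumes "test_fun \<Omega> f" "test_fun \<Omega> g"
  shows "test_fun \<Omega> (\<lambda>x. f x + g x)"
proof -
  have sub: "closure {x. f x + g x \<noteq> 0} \<subseteq> closure {x. f x \<noteq> 0} \<union> closure {x. g x \<noteq> 0}"
    unfolding closure_Un[symmetric] by (rule closure_mono) auto
  moreover have "compact (closure {x. f x \<noteq> 0} \<union> closure {x. g x \<noteq> 0})"
    by (intro compact_Un test_funD(5)[OF assms(1)] test_funD(5)[OF assms(2)])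
  ultimately have "compact (closure {x. f x + g x \<noteq> 0})"
    using bounded_subset unfolding compact_eq_bounded_closed by blast
  with sub show ?thesis
    using smooth_fun_add[OF test_funD(1)[OF assms(1)] test_funD(1)[OF assms(2)]]
      test_funD(6)[OF assms(1)] test_funD(6)[OF assms(2)]
    unfolding test_fun_def by blast
qed

lemma test_fun_pderiv:
  assumes "test_fun \<Omega> f" "i \<in> Basis"
  shows "test_fun \<Omega> (pderiv_dir f i)"
proof (rule test_fun_subset[OF _ assms(1)])
  show "smooth_fun (pderiv_dir f i)"
    by (rule smooth_funD(3)[OF test_funD(1)[OF assms(1)] assms(2)])
  \<comment> \<open>Off its closed support \<open>f\<close> is zero on a whole neighbourhood, hence
    has zero derivative there.\<close>
  have "pderiv_dir f i x = 0" if "x \<notin> closure {x. f x \<noteq> 0}" for x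
  proof (rule pderiv_dir_eq)
    show "(f has_derivative (\<lambda>h. 0)) (at x)"
    proof (rule has_derivative_transform_within_open[OF has_derivative_const])
      show "open (- closure {x. f x \<noteq> 0})" by auto
      show "x \<in> - closure {x. f x \<noteq> 0}" using that by simp
      show "0 = f y" if "y \<in> - closure {x. f x \<noteq> 0}" for y
        using test_funD(7)[OF assms(1), of y] that by (metis ComplD)
    qed
  qed
  then show "{x. pderiv_dir f i x \<noteq> 0} \<subseteq> closure {x. f x \<noteq> 0}" by blast
qed

section \<open>Integration of test functions and integration by parts\<close>

lemma test_fun_bounded:
  assumes "test_fun \<Omega> f"
  obtains B where "B > 0" "\<And>x. \<bar>f x\<bar> \<le> B"
proof -
  let ?K = "closure {x. f x \<noteq> 0}"
  have "bounded (f ` ?K)"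
    using test_funD(2,5)[OF assms] by (intro compact_imp_bounded compact_continuous_image)
      (auto intro: continuous_on_subset)
  then obtain B where B: "B > 0" "\<And>x. x \<in> ?K \<Longrightarrow> \<bar>f x\<bar> \<le> B"
    by (auto simp: bounded_pos)
  have "\<bar>f x\<bar> \<le> B" for x
    using B less_imp_le[OF B(1)] test_funD(7)[OF assms, of x] by (metis abs_zero)
  with B that show ?thesis by blast
qed

lemma test_fun_measurable: "test_fun \<Omega> f \<Longrightarrow> f \<in> borel_measurable borel"
  by (rule borel_measurable_continuous_onI[OF test_funD(2)])

lemma test_fun_integrable:
  assumes "test_fun \<Omega> f"
  shows "integrable lborel f"
proof -
  let ?K = "closure {x. f x \<noteq> 0}"
  have int: "integrable lborel (\<lambda>x. indicator ?K x *\<^sub>R f x)"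
    using test_funD(2,5)[OF assms] by (intro borel_integrable_compact) (auto intro: continuous_on_subset)
  have "(\<lambda>x. indicator ?K x *\<^sub>R f x) = f"
  proof
    show "indicator ?K x *\<^sub>R f x = f x" for x
      using test_funD(7)[OF assms, of x] by (metis indicator_simps scaleR_one scaleR_zero_right)
  qed
  from subst[of _ _ "integrable lborel", OF this int] show ?thesis .
qed

text \<open>Extension by zero: passing to the whole space makes translation invariance available for
  integrals over \<Omega>.\<close>

lemma
  assumes "test_fun \<Omega> f" "open \<Omega>"
  shows test_fun_integrable_on: "integrable (lebesgue_on \<Omega>) f"
    and test_fun_integral_on: "integral\<^sup>L (lebesgue_on \<Omega>) f = integral\<^sup>L lborel f"
proof -
  have *: "(\<lambda>x. indicator \<Omega> x *\<^sub>R f x) = f"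
  proof
    show "indicator \<Omega> x *\<^sub>R f x = f x" for x
      using test_funD(8)[OF assms(1), of x] by (cases "x \<in> \<Omega>") simp_all
  qed
  show "integrable (lebesgue_on \<Omega>) f" "integral\<^sup>L (lebesgue_on \<Omega>) f = integral\<^sup>L lborel f"
    using assms test_fun_integrable[OF assms(1)] test_fun_measurable[OF assms(1)]
    by (subst integrable_restrict_space integral_restrict_space,
        simp, simp only: *, simp add: integrable_completion integral_completion)+
qed

text \<open>Translation invariance makes the integral of every difference quotient vanish; dominated
  convergence passes to the limit.\<close>
lemma test_fun_integral_pderiv:
  fixes f :: "'a::euclidean_space \<Rightarrow> real"
  assumes f: "test_fun \<Omega> f" and i: "i \<in> Basis"
  shows "(\<integral>x. pderiv_dir f i x \<partial>lborel) = 0"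
proof -
  obtain B where B: "B > 0" "\<And>x. \<bar>pderiv_dir f i x\<bar> \<le> B"
    using test_fun_bounded[OF test_fun_pderiv[OF f i]] by metis
  obtain R where R: "\<And>x. f x \<noteq> 0 \<Longrightarrow> norm x \<le> R"
    using test_funD(5)[OF f] closure_subset[of "{x. f x \<noteq> 0}"]
    unfolding compact_eq_bounded_closed bounded_iff by blast
  define h where "h n = 1 / real (Suc n)" for n
  have h: "h n > 0" "h n \<le> 1" for n
    by (auto simp: h_def)
  have h0: "h \<longlonglongrightarrow> 0"
    unfolding h_def by (rule LIMSEQ_Suc[OF lim_1_over_n])
  define s where "s n x = (f (h n *\<^sub>R i + x) - f x) / h n" for n x
  have fm [measurable]: "f \<in> borel_measurable borel" using f by (rule test_fun_measurable)
  have pm [measurable]: "pderiv_dir f i \<in> borel_measurable borel"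
    using test_fun_measurable[OF test_fun_pderiv[OF f i]] .
  have D: "((\<lambda>t. f (t *\<^sub>R i + x)) has_real_derivative pderiv_dir f i (t *\<^sub>R i + x)) (at t)" for t x
  proof -
    have "((\<lambda>t. f (t *\<^sub>R i + x)) has_derivative (\<lambda>d. cgrad f (t *\<^sub>R i + x) \<bullet> (d *\<^sub>R i))) (at t)"
      by (rule has_derivative_compose[OF _ test_funD(4)[OF f]]) (auto intro!: derivative_eq_intros)
    then show ?thesis
      by (simp add: has_field_derivative_def cgrad_inner_Basis[OF i] mult_commute_abs)
  qed
  have int: "integrable lborel (\<lambda>x. f (c + x))" "(\<integral>x. f (c + x) \<partial>lborel) = (\<integral>x. f x \<partial>lborel)" for c
  proof -
    have "integrable (distr lborel borel ((+) c)) f"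
      using test_fun_integrable[OF f] by (simp add: lborel_distr_plus)
    then show "integrable lborel (\<lambda>x. f (c + x))"
      by (subst (asm) integrable_distr_eq) auto
    have "(\<integral>x. f x \<partial>lborel) = (\<integral>x. f x \<partial>distr lborel borel ((+) c))"
      by (simp add: lborel_distr_plus)
    also have "\<dots> = (\<integral>x. f (c + x) \<partial>lborel)"
      by (subst integral_distr) auto
    finally show "(\<integral>x. f (c + x) \<partial>lborel) = (\<integral>x. f x \<partial>lborel)" by simp
  qed
  have s0: "(\<integral>x. s n x \<partial>lborel) = 0" for n
    using int[of "h n *\<^sub>R i"] test_fun_integrable[OF f] by (simp add: s_def)
  \<comment> \<open>By the mean value theorem each difference quotient is a value of the derivative,
    hence bounded by \<open>B\<close>. As the steps \<open>h n\<close> are at most 1, all quotients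
    vanish outside the ball of radius \<open>R + 1\<close>.\<close>
  have "(\<lambda>n. \<integral>x. s n x \<partial>lborel) \<longlonglongrightarrow> (\<integral>x. pderiv_dir f i x \<partial>lborel)"
  proof (rule integral_dominated_convergence[where w="\<lambda>x. indicator (cball 0 (R + 1)) x *\<^sub>R B"])
    show "integrable lborel (\<lambda>x. indicator (cball 0 (R + 1)) x *\<^sub>R B)"
      by (rule borel_integrable_compact) auto
    show "AE x in lborel. (\<lambda>n. s n x) \<longlonglongrightarrow> pderiv_dir f i x"
    proof (rule AE_I2)
      fix x
      have "((\<lambda>t. (f (t *\<^sub>R i + x) - f x) / t) \<longlongrightarrow> pderiv_dir f i x) (at 0)"
        using D[of x 0] unfolding DERIV_def by simp
      moreover have "filterlim h (at 0) sequentially"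
        unfolding filterlim_at using h0 h(1) by (auto intro!: always_eventually simp: less_imp_neq[symmetric])
      ultimately show "(\<lambda>n. s n x) \<longlonglongrightarrow> pderiv_dir f i x"
        unfolding s_def by (rule filterlim_compose)
    qed
    show "AE x in lborel. norm (s n x) \<le> indicator (cball 0 (R + 1)) x *\<^sub>R B" for n
    proof (rule AE_I2)
      fix x
      show "norm (s n x) \<le> indicator (cball 0 (R + 1)) x *\<^sub>R B"
      proof (cases "x \<in> cball 0 (R + 1)")
        case True
        obtain t where "f (h n *\<^sub>R i + x) - f (0 *\<^sub>R i + x) = (h n - 0) * pderiv_dir f i (t *\<^sub>R i + x)"
          using MVT2[OF h(1), of n "\<lambda>t. f (t *\<^sub>R i + x)" "\<lambda>t. pderiv_dir f i (t *\<^sub>R i + x)"] D[of x]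
          by blast
        then have "s n x = pderiv_dir f i (t *\<^sub>R i + x)"
          using h(1)[of n] by (simp add: s_def)
        then show ?thesis using B True by simp
      next
        case False
        have "norm x \<le> norm (h n *\<^sub>R i + x) + norm (h n *\<^sub>R i)"
          by (metis add_diff_cancel_left' norm_triangle_sub norm_minus_commute add.commute norm_triangle_ineq4)
        also have "norm (h n *\<^sub>R i) \<le> 1" using h[of n] i by simp
        finally have "norm (h n *\<^sub>R i + x) > R" "norm x > R" using False by auto
        then have "f (h n *\<^sub>R i + x) = 0" "f x = 0" using R by fastforce+
        then show ?thesis using False by (simp add: s_def)
      qed
    qed
  qed (auto simp: s_def)
  then show ?thesis by (simp add: s0 LIMSEQ_const_iff)
qed

text \<open>Integration by parts: the product of two test functions is a test function, so its
  partial derivative, expanded by the product rule, integrates to zero.\<close>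

lemma test_fun_weak_grad:
  assumes "test_fun \<Omega> f" "open \<Omega>"
  shows "weak_grad \<Omega> f (cgrad f)"
  unfolding weak_grad_def
proof (intro allI impI)
  fix \<psi> and i :: 'a
  assume "test_fun \<Omega> \<psi> \<and> i \<in> Basis"
  then have psi: "test_fun \<Omega> \<psi>" and i: "i \<in> Basis" by auto
  have t1: "test_fun \<Omega> (\<lambda>x. f x * pderiv_dir \<psi> i x)"
    by (rule test_fun_mult[OF test_funD(1)[OF assms(1)] test_fun_pderiv[OF psi i]])
  have t2: "test_fun \<Omega> (\<lambda>x. pderiv_dir f i x * \<psi> x)"
    by (rule test_fun_mult[OF test_funD(1)[OF test_fun_pderiv[OF assms(1) i]] psi])
  have t3: "test_fun \<Omega> (\<lambda>x. f x * \<psi> x)"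
    by (rule test_fun_mult[OF test_funD(1)[OF assms(1)] psi])
  have "f differentiable_on UNIV" "\<psi> differentiable_on UNIV"
    by (rule smooth_funD(2)[OF test_funD(1)], fact)+
  then have "(\<integral>x. f x * pderiv_dir \<psi> i x + pderiv_dir f i x * \<psi> x \<partial>lborel) = 0"
    using test_fun_integral_pderiv[OF t3 i] by (simp add: pderiv_dir_mult)
  then have "(\<integral>x. f x * pderiv_dir \<psi> i x \<partial>lborel) = - (\<integral>x. pderiv_dir f i x * \<psi> x \<partial>lborel)"
    using test_fun_integrable[OF t1] test_fun_integrable[OF t2] by simp
  then show "integrable (lebesgue_on \<Omega>) (\<lambda>x. f x * pderiv_dir \<psi> i x)
    \<and> integrable (lebesgue_on \<Omega>) (\<lambda>x. (cgrad f x \<bullet> i) * \<psi> x)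
    \<and> (\<integral>x. f x * pderiv_dir \<psi> i x \<partial>lebesgue_on \<Omega>)
        = - (\<integral>x. (cgrad f x \<bullet> i) * \<psi> x \<partial>lebesgue_on \<Omega>)"
    using assms(2) t1 t2
    by (simp add: cgrad_inner_Basis[OF i] test_fun_integrable_on test_fun_integral_on)
qed

subsection \<open>Polynomial approximation in \<open>C\<^sup>1\<close>\<close>

text \<open>Weierstrass approximation is applied to the derivative, and the approximant is
  integrated term by term from the value \<open>H 0\<close>. Exactness at 0 matters later: if
  \<open>H 0 = 0\<close>, composing with a test function does not enlarge its support.\<close>

lemma C1_polynomial_approx:
  fixes H H' :: "real \<Rightarrow> real"
  assumes H: "\<And>s. (H has_real_derivative H' s) (at s)" "continuous_on UNIV H'"
    and "R \<ge> 0" "e > 0"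
  obtains p p' where "real_polynomial_function p" "\<And>s. (p has_real_derivative p' s) (at s)"
    "continuous_on UNIV p'" "p 0 = H 0" "\<And>s. \<bar>s\<bar> \<le> R \<Longrightarrow> \<bar>p s - H s\<bar> \<le> e" "\<And>s. \<bar>s\<bar> \<le> R \<Longrightarrow> \<bar>p' s - H' s\<bar> \<le> e"
proof -
  \<comment> \<open>Integrating an error \<open>d\<close> over a length of at most \<open>R\<close>
    costs a factor \<open>R\<close>; this choice keeps both \<open>d\<close> and
    \<open>R * d\<close> below \<open>e\<close>.\<close>
  define d where "d = e / (1 + R)"
  have d: "d > 0" "d \<le> e" "R * d \<le> e"
    using assms by (auto simp: d_def field_simps)
  obtain q where q: "real_polynomial_function q" "\<And>s. s \<in> {-R..R} \<Longrightarrow> \<bar>H' s - q s\<bar> < d"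
    using Stone_Weierstrass_real_polynomial_function[of "{-R..R}" H' d] d H(2)
    by (auto intro: continuous_on_subset)
  obtain a n where a: "q = (\<lambda>x. \<Sum>i\<le>n. a i * x ^ i)"
    using q(1) real_polynomial_function_iff_sum by blast
  define p where "p x = H 0 + (\<Sum>i\<le>n. a i / (1 + real i) * x ^ (Suc i))" for x
  have 1: "real_polynomial_function p"
    unfolding p_def
    by (intro real_polynomial_function.intros real_polynomial_function_sum
        real_polynomial_function_power bounded_linear_ident) auto
  have 2: "(p has_real_derivative q s) (at s)" for s
  proof -
    have "((\<lambda>x. a i / (1 + real i) * x ^ (Suc i)) has_real_derivative a i * s ^ i) (at s)" for i
      using DERIV_cmult[OF DERIV_pow[of "Suc i" s], of "a i / (1 + real i)"] by simp
    from DERIV_add[OF DERIV_const DERIV_sum[OF this]] show ?thesis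
      unfolding p_def a by simp
  qed
  have 3: "p 0 = H 0" by (simp add: p_def)
  have 4: "\<bar>q s - H' s\<bar> \<le> d" if "\<bar>s\<bar> \<le> R" for s
    using q(2)[of s] that by (auto simp: abs_le_iff)
  have 5: "\<bar>p s - H s\<bar> \<le> e" if "\<bar>s\<bar> \<le> R" for s
  proof -
    have "norm ((p s - H s) - (p 0 - H 0)) \<le> d * norm (s - 0)"
    proof (rule field_differentiable_bound[of "{-R..R}" "\<lambda>s. p s - H s" "\<lambda>s. q s - H' s"])
      show "((\<lambda>s. p s - H s) has_field_derivative q z - H' z) (at z within {- R..R})" for z
        using 2 H(1) by (auto intro!: derivative_intros intro: has_field_derivative_at_within)
    qed (use 4 that assms in auto)
    also have "\<dots> \<le> d * R" using that d by simp
    finally show ?thesis using d 3 by (simp add: mult.commute)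
  qed
  show ?thesis
  proof (rule that[OF 1 2 _ 3])
    show "continuous_on UNIV q"
      using q(1) by (simp add: continuous_on_polymonial_function real_polynomial_function_eq)
    show "\<bar>p s - H s\<bar> \<le> e" if "\<bar>s\<bar> \<le> R" for s using 5[OF that] .
    show "\<bar>q s - H' s\<bar> \<le> e" if "\<bar>s\<bar> \<le> R" for s using 4[OF that] d(2) by linarith
  qed
qed

subsection \<open>Convergence in \<open>L\<^sup>2\<close> and \<open>H\<^sub>0\<^sup>1\<close>\<close>

lemma norm_add_power2_le:
  fixes a b :: "'b::real_normed_vector"
  shows "(norm (a + b))\<^sup>2 \<le> 2 * (norm a)\<^sup>2 + 2 * (norm b)\<^sup>2"
proof -
  have "(norm (a + b))\<^sup>2 \<le> (norm a + norm b)\<^sup>2"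
    by (intro power_mono norm_triangle_ineq) auto
  also have "\<dots> \<le> 2 * (norm a)\<^sup>2 + 2 * (norm b)\<^sup>2"
    using sum_squares_bound[of "norm a" "norm b"] by (simp add: power2_sum)
  finally show ?thesis .
qed

lemma L2_measurable: "L2 \<Omega> f \<Longrightarrow> f \<in> borel_measurable (lebesgue_on \<Omega>)"
  and L2_integrable: "L2 \<Omega> f \<Longrightarrow> integrable (lebesgue_on \<Omega>) (\<lambda>x. (norm (f x))\<^sup>2)"
  by (auto simp: L2_def)

lemma L2_add:
  assumes "L2 \<Omega> f" "L2 \<Omega> g"
  shows "L2 \<Omega> (\<lambda>x. f x + g x)"
proof -
  note [measurable] = L2_measurable[OF assms(1)] L2_measurable[OF assms(2)]
  have "integrable (lebesgue_on \<Omega>) (\<lambda>x. (norm (f x + g x))\<^sup>2)"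
    by (rule Bochner_Integration.integrable_bound[where f="\<lambda>x. 2 * (norm (f x))\<^sup>2 + 2 * (norm (g x))\<^sup>2"])
      (auto simp: L2_integrable assms norm_add_power2_le)
  then show ?thesis by (auto simp: L2_def)
qed

lemma L2_bounded_scaleR:
  assumes [measurable]: "a \<in> borel_measurable (lebesgue_on \<Omega>)"
    and "AE x in lebesgue_on \<Omega>. \<bar>a x\<bar> \<le> C" and f: "L2 \<Omega> f"
  shows "L2 \<Omega> (\<lambda>x. a x *\<^sub>R f x)"
proof -
  note [measurable] = L2_measurable[OF f]
  have b: "AE x in lebesgue_on \<Omega>. norm ((norm (a x *\<^sub>R f x))\<^sup>2) \<le> norm (C\<^sup>2 * (norm (f x))\<^sup>2)"
    using assms(2)
  proof eventually_elim
    case (elim x)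
    then have "\<bar>a x\<bar>\<^sup>2 \<le> C\<^sup>2" by (intro power_mono) auto
    from mult_right_mono[OF this zero_le_power2[of "norm (f x)"]]
    show ?case by (simp add: power_mult_distrib)
  qed
  have "integrable (lebesgue_on \<Omega>) (\<lambda>x. C\<^sup>2 * (norm (f x))\<^sup>2)"
    using L2_integrable[OF f] by simp
  from Bochner_Integration.integrable_bound[OF this _ b]
  have "integrable (lebesgue_on \<Omega>) (\<lambda>x. (norm (a x *\<^sub>R f x))\<^sup>2)"
    by simp
  then show ?thesis by (auto simp: L2_def)
qed

lemma L2_scaleR: "L2 \<Omega> f \<Longrightarrow> L2 \<Omega> (\<lambda>x. c *\<^sub>R f x)"
  by (rule L2_bounded_scaleR[where C="\<bar>c\<bar>"]) auto

lemma L2_diff: "L2 \<Omega> f \<Longrightarrow> L2 \<Omega> g \<Longrightarrow> L2 \<Omega> (\<lambda>x. f x - g x)"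
  using L2_add[of \<Omega> f "\<lambda>x. (-1) *\<^sub>R g x"] L2_scaleR[of \<Omega> g "-1"] by simp

lemma L2_inner_left: "L2 \<Omega> f \<Longrightarrow> L2 \<Omega> (\<lambda>x. f x \<bullet> i)"
proof -
  assume f: "L2 \<Omega> f"
  note [measurable] = L2_measurable[OF f]
  have b: "(f x \<bullet> i)\<^sup>2 \<le> (norm i)\<^sup>2 * (norm (f x))\<^sup>2" for x
    using power_mono[OF Cauchy_Schwarz_ineq2[of "f x" i], of 2] by (simp add: power_mult_distrib mult.commute)
  have "integrable (lebesgue_on \<Omega>) (\<lambda>x. (norm i)\<^sup>2 * (norm (f x))\<^sup>2)"
    using L2_integrable[OF f] by simp
  then have "integrable (lebesgue_on \<Omega>) (\<lambda>x. (norm (f x \<bullet> i))\<^sup>2)"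
    by (rule Bochner_Integration.integrable_bound) (use b in auto)
  then show ?thesis by (auto simp: L2_def)
qed

lemma L2_mult_integrable:
  fixes f g :: "'a::euclidean_space \<Rightarrow> real"
  assumes "L2 \<Omega> f" "L2 \<Omega> g"
  shows "integrable (lebesgue_on \<Omega>) (\<lambda>x. f x * g x)"
proof (rule Bochner_Integration.integrable_bound[where f="\<lambda>x. (norm (f x))\<^sup>2 + (norm (g x))\<^sup>2"])
  note [measurable] = L2_measurable[OF assms(1)] L2_measurable[OF assms(2)]
  show "(\<lambda>x. f x * g x) \<in> borel_measurable (lebesgue_on \<Omega>)" by simp
  show "integrable (lebesgue_on \<Omega>) (\<lambda>x. (norm (f x))\<^sup>2 + (norm (g x))\<^sup>2)"
    by (intro Bochner_Integration.integrable_add L2_integrable assms)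
  have "\<bar>f x * g x\<bar> \<le> (f x)\<^sup>2 + (g x)\<^sup>2" for x
  proof -
    have "2 * \<bar>f x * g x\<bar> \<le> (f x)\<^sup>2 + (g x)\<^sup>2"
      using sum_squares_bound[of "\<bar>f x\<bar>" "\<bar>g x\<bar>"] by (simp add: abs_mult)
    then show ?thesis using abs_ge_zero[of "f x * g x"] by linarith
  qed
  then show "AE x in lebesgue_on \<Omega>. norm (f x * g x) \<le> norm ((norm (f x))\<^sup>2 + (norm (g x))\<^sup>2)"
    by simp
qed

text \<open>A weighted Young inequality takes the place of Cauchy-Schwarz for integrals.\<close>

lemma L2_integral_mult_tendsto_0:
  fixes d :: "nat \<Rightarrow> 'a::euclidean_space \<Rightarrow> real"
  assumes d: "\<And>n. L2 \<Omega> (d n)" and g: "L2 \<Omega> g"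
    and lim: "(\<lambda>n. \<integral>x. (d n x)\<^sup>2 \<partial>lebesgue_on \<Omega>) \<longlonglongrightarrow> 0"
  shows "(\<lambda>n. \<integral>x. d n x * g x \<partial>lebesgue_on \<Omega>) \<longlonglongrightarrow> 0"
proof (rule LIMSEQ_I)
  fix e :: real assume e: "e > 0"
  define G where "G = (\<integral>x. (g x)\<^sup>2 \<partial>lebesgue_on \<Omega>)"
  have G: "G \<ge> 0" by (simp add: G_def)
  \<comment> \<open>The weight in \<open>\<bar>a * b\<bar> \<le> a\<^sup>2 / (2 * t) + t / 2 *
    b\<^sup>2\<close>. It makes the \<open>g\<close> term smaller than \<open>e / 2\<close>, and the
    \<open>d\<close> term follows once its integral is below \<open>t * e\<close>. The summand 1
    covers \<open>G = 0\<close>.\<close>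
  define t where "t = e / (G + 1)"
  have t: "t > 0" "t * G < e" using e G by (auto simp: t_def field_simps)
  obtain N where N: "\<And>n. n \<ge> N \<Longrightarrow> norm ((\<integral>x. (d n x)\<^sup>2 \<partial>lebesgue_on \<Omega>) - 0) < t * e"
    using LIMSEQ_D[OF lim, of "t * e"] t e by auto
  have int: "integrable (lebesgue_on \<Omega>) (\<lambda>x. (d n x)\<^sup>2)" "integrable (lebesgue_on \<Omega>) (\<lambda>x. (g x)\<^sup>2)" for n
    using L2_integrable[OF d[of n]] L2_integrable[OF g] by auto
  have "norm ((\<integral>x. d n x * g x \<partial>lebesgue_on \<Omega>) - 0) < e" if n: "n \<ge> N" for n
  proof -
    have ineq: "\<bar>a * b\<bar> \<le> a\<^sup>2 / (2 * t) + t / 2 * b\<^sup>2" for a b :: real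
    proof -
      have "2 * (\<bar>a\<bar> * (t * \<bar>b\<bar>)) \<le> \<bar>a\<bar>\<^sup>2 + (t * \<bar>b\<bar>)\<^sup>2"
        using sum_squares_bound[of "\<bar>a\<bar>" "t * \<bar>b\<bar>"] by (simp add: mult.assoc)
      then show ?thesis
        using t(1) by (simp add: field_simps abs_mult power2_eq_square)
    qed
    have "norm (\<integral>x. d n x * g x \<partial>lebesgue_on \<Omega>) \<le> (\<integral>x. norm (d n x * g x) \<partial>lebesgue_on \<Omega>)"
      by (rule integral_norm_bound)
    also have "\<dots> \<le> (\<integral>x. (d n x)\<^sup>2 / (2 * t) + t / 2 * (g x)\<^sup>2 \<partial>lebesgue_on \<Omega>)"
      using L2_mult_integrable[OF d[of n] g] int ineq by (intro integral_mono) auto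
    also have "\<dots> = (\<integral>x. (d n x)\<^sup>2 \<partial>lebesgue_on \<Omega>) / (2 * t) + t / 2 * G"
      using int by (simp add: G_def)
    also have "\<dots> < e"
    proof -
      have "(\<integral>x. (d n x)\<^sup>2 \<partial>lebesgue_on \<Omega>) < t * e" using N[OF n] by auto
      then have "(\<integral>x. (d n x)\<^sup>2 \<partial>lebesgue_on \<Omega>) / (2 * t) < e / 2"
        using t by (simp add: field_simps)
      then show ?thesis using t(2) by linarith
    qed
    finally show ?thesis by simp
  qed
  then show "\<exists>N. \<forall>n\<ge>N. norm ((\<integral>x. d n x * g x \<partial>lebesgue_on \<Omega>) - 0) < e" by blast
qed

lemma L2_tendsto_add:
  assumes L: "\<And>n. L2 \<Omega> (f n)" "L2 \<Omega> f0" "\<And>n. L2 \<Omega> (g n)" "L2 \<Omega> g0"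
    and f: "(\<lambda>n. \<integral>x. (norm (f n x - f0 x))\<^sup>2 \<partial>lebesgue_on \<Omega>) \<longlonglongrightarrow> 0"
    and g: "(\<lambda>n. \<integral>x. (norm (g n x - g0 x))\<^sup>2 \<partial>lebesgue_on \<Omega>) \<longlonglongrightarrow> 0"
  shows "(\<lambda>n. \<integral>x. (norm ((f n x + g n x) - (f0 x + g0 x)))\<^sup>2 \<partial>lebesgue_on \<Omega>) \<longlonglongrightarrow> 0"
proof (rule tendsto_sandwich[OF _ _ tendsto_const])
  show "\<forall>\<^sub>F n in sequentially. 0 \<le> (\<integral>x. (norm ((f n x + g n x) - (f0 x + g0 x)))\<^sup>2 \<partial>lebesgue_on \<Omega>)"
    by simp
  let ?B = "\<lambda>n. 2 * (\<integral>x. (norm (f n x - f0 x))\<^sup>2 \<partial>lebesgue_on \<Omega>)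
      + 2 * (\<integral>x. (norm (g n x - g0 x))\<^sup>2 \<partial>lebesgue_on \<Omega>)"
  show "?B \<longlonglongrightarrow> 0"
    using tendsto_add[OF tendsto_mult_left[OF f, of 2] tendsto_mult_left[OF g, of 2]] by simp
  have "(\<integral>x. (norm ((f n x + g n x) - (f0 x + g0 x)))\<^sup>2 \<partial>lebesgue_on \<Omega>) \<le> ?B n" for n
  proof -
    have i1: "integrable (lebesgue_on \<Omega>) (\<lambda>x. (norm (f n x - f0 x))\<^sup>2)"
      and i2: "integrable (lebesgue_on \<Omega>) (\<lambda>x. (norm (g n x - g0 x))\<^sup>2)"
      and i3: "integrable (lebesgue_on \<Omega>) (\<lambda>x. (norm ((f n x + g n x) - (f0 x + g0 x)))\<^sup>2)"
      by (intro L2_integrable L2_diff L2_add L)+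
    have "(\<integral>x. (norm ((f n x + g n x) - (f0 x + g0 x)))\<^sup>2 \<partial>lebesgue_on \<Omega>)
        \<le> (\<integral>x. 2 * (norm (f n x - f0 x))\<^sup>2 + 2 * (norm (g n x - g0 x))\<^sup>2 \<partial>lebesgue_on \<Omega>)"
    proof (rule integral_mono[OF i3])
      show "(norm ((f n x + g n x) - (f0 x + g0 x)))\<^sup>2
          \<le> 2 * (norm (f n x - f0 x))\<^sup>2 + 2 * (norm (g n x - g0 x))\<^sup>2" for x
        using norm_add_power2_le[of "f n x - f0 x" "g n x - g0 x"] by (simp add: algebra_simps)
    qed (use i1 i2 in auto)
    then show ?thesis using i1 i2 by simp
  qed
  then show "\<forall>\<^sub>F n in sequentially. (\<integral>x. (norm ((f n x + g n x) - (f0 x + g0 x)))\<^sup>2 \<partial>lebesgue_on \<Omega>) \<le> ?B n"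
    by simp
qed

text \<open>Dominated convergence with majorant
  \<open>(2 * C)\<^sup>2 * (norm (g x))\<^sup>2\<close>; uniform bounds and a.e. convergence of the
  coefficients suffice because \<open>g\<close> is fixed.\<close>

lemma L2_tendsto_bounded_scaleR_const:
  assumes a: "\<And>n. a n \<in> borel_measurable (lebesgue_on \<Omega>)" "a0 \<in> borel_measurable (lebesgue_on \<Omega>)"
    and b: "\<And>n. AE x in lebesgue_on \<Omega>. \<bar>a n x\<bar> \<le> C" "AE x in lebesgue_on \<Omega>. \<bar>a0 x\<bar> \<le> C"
    and lim: "AE x in lebesgue_on \<Omega>. (\<lambda>n. a n x) \<longlonglongrightarrow> a0 x"
    and g: "L2 \<Omega> g"
  shows "(\<lambda>n. \<integral>x. (norm (a n x *\<^sub>R g x - a0 x *\<^sub>R g x))\<^sup>2 \<partial>lebesgue_on \<Omega>) \<longlonglongrightarrow> 0"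
proof -
  note [measurable] = L2_measurable[OF g] a
  have "(\<lambda>n. \<integral>x. (norm (a n x *\<^sub>R g x - a0 x *\<^sub>R g x))\<^sup>2 \<partial>lebesgue_on \<Omega>)
      \<longlonglongrightarrow> (\<integral>x. 0 \<partial>lebesgue_on \<Omega>)"
  proof (rule integral_dominated_convergence[where w="\<lambda>x. (2 * C)\<^sup>2 * (norm (g x))\<^sup>2"])
    show "integrable (lebesgue_on \<Omega>) (\<lambda>x. (2 * C)\<^sup>2 * (norm (g x))\<^sup>2)"
      using L2_integrable[OF g] by simp
    show "AE x in lebesgue_on \<Omega>. (\<lambda>n. (norm (a n x *\<^sub>R g x - a0 x *\<^sub>R g x))\<^sup>2) \<longlonglongrightarrow> 0"
      using lim
    proof eventually_elim
      case (elim x)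
      have "(\<lambda>n. (norm (a n x *\<^sub>R g x - a0 x *\<^sub>R g x))\<^sup>2)
          \<longlonglongrightarrow> (norm (a0 x *\<^sub>R g x - a0 x *\<^sub>R g x))\<^sup>2"
        by (intro tendsto_intros elim)
      then show ?case by simp
    qed
    show "AE x in lebesgue_on \<Omega>. norm ((norm (a n x *\<^sub>R g x - a0 x *\<^sub>R g x))\<^sup>2) \<le> (2 * C)\<^sup>2 * (norm (g x))\<^sup>2" for n
      using b(1)[of n] b(2)
    proof eventually_elim
      case (elim x)
      then have "\<bar>a n x - a0 x\<bar>\<^sup>2 \<le> (2 * C)\<^sup>2" by (intro power_mono) auto
      from mult_right_mono[OF this zero_le_power2[of "norm (g x)"]] show ?case
        by (simp add: scaleR_left_diff_distrib[symmetric] power_mult_distrib)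
    qed
  qed auto
  then show ?thesis by simp
qed

text \<open>Split the error as \<open>a n (g n - g0) + (a n - a0) g0\<close>: the first part is
  small by the uniform bound on \<open>a n\<close>, the second by the case of a fixed
  function.\<close>

lemma L2_tendsto_bounded_scaleR:
  assumes a: "\<And>n. a n \<in> borel_measurable (lebesgue_on \<Omega>)" "a0 \<in> borel_measurable (lebesgue_on \<Omega>)"
    and b: "\<And>n. AE x in lebesgue_on \<Omega>. \<bar>a n x\<bar> \<le> C" "AE x in lebesgue_on \<Omega>. \<bar>a0 x\<bar> \<le> C"
    and lim: "AE x in lebesgue_on \<Omega>. (\<lambda>n. a n x) \<longlonglongrightarrow> a0 x"
    and L: "\<And>n. L2 \<Omega> (g n)" "L2 \<Omega> g0"
    and g: "(\<lambda>n. \<integral>x. (norm (g n x - g0 x))\<^sup>2 \<partial>lebesgue_on \<Omega>) \<longlonglongrightarrow> 0"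
  shows "(\<lambda>n. \<integral>x. (norm (a n x *\<^sub>R g n x - a0 x *\<^sub>R g0 x))\<^sup>2 \<partial>lebesgue_on \<Omega>) \<longlonglongrightarrow> 0"
proof -
  have 1: "(\<lambda>n. \<integral>x. (norm (a n x *\<^sub>R (g n x - g0 x) - 0))\<^sup>2 \<partial>lebesgue_on \<Omega>) \<longlonglongrightarrow> 0"
  proof (rule tendsto_sandwich[OF _ _ tendsto_const])
    show "(\<lambda>n. C\<^sup>2 * (\<integral>x. (norm (g n x - g0 x))\<^sup>2 \<partial>lebesgue_on \<Omega>)) \<longlonglongrightarrow> 0"
      using tendsto_mult_left[OF g, of "C\<^sup>2"] by simp
    have "(\<integral>x. (norm (a n x *\<^sub>R (g n x - g0 x) - 0))\<^sup>2 \<partial>lebesgue_on \<Omega>)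
        \<le> (\<integral>x. C\<^sup>2 * (norm (g n x - g0 x))\<^sup>2 \<partial>lebesgue_on \<Omega>)" for n
    proof (rule integral_mono_AE)
      show "integrable (lebesgue_on \<Omega>) (\<lambda>x. (norm (a n x *\<^sub>R (g n x - g0 x) - 0))\<^sup>2)"
        using L2_integrable[OF L2_bounded_scaleR[OF a(1) b(1) L2_diff[OF L]]] by simp
      show "integrable (lebesgue_on \<Omega>) (\<lambda>x. C\<^sup>2 * (norm (g n x - g0 x))\<^sup>2)"
        using L2_integrable[OF L2_diff[OF L]] by simp
      show "AE x in lebesgue_on \<Omega>. (norm (a n x *\<^sub>R (g n x - g0 x) - 0))\<^sup>2 \<le> C\<^sup>2 * (norm (g n x - g0 x))\<^sup>2"
        using b(1)[of n]
      proof eventually_elim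
        case (elim x)
        then have "\<bar>a n x\<bar>\<^sup>2 \<le> C\<^sup>2" by (intro power_mono) auto
        from mult_right_mono[OF this zero_le_power2[of "norm (g n x - g0 x)"]]
        show ?case by (simp add: power_mult_distrib)
      qed
    qed
    then show "\<forall>\<^sub>F n in sequentially. (\<integral>x. (norm (a n x *\<^sub>R (g n x - g0 x) - 0))\<^sup>2 \<partial>lebesgue_on \<Omega>)
        \<le> C\<^sup>2 * (\<integral>x. (norm (g n x - g0 x))\<^sup>2 \<partial>lebesgue_on \<Omega>)"
      by simp
  qed simp
  have 2: "(\<lambda>n. \<integral>x. (norm (a n x *\<^sub>R g0 x - a0 x *\<^sub>R g0 x))\<^sup>2 \<partial>lebesgue_on \<Omega>) \<longlonglongrightarrow> 0"
    by (rule L2_tendsto_bounded_scaleR_const[OF a b lim L(2)])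
  have "(\<lambda>n. \<integral>x. (norm ((a n x *\<^sub>R (g n x - g0 x) + a n x *\<^sub>R g0 x) - (0 + a0 x *\<^sub>R g0 x)))\<^sup>2 \<partial>lebesgue_on \<Omega>)
      \<longlonglongrightarrow> 0"
  proof (rule L2_tendsto_add[OF _ _ _ _ 1 2])
    show "L2 \<Omega> (\<lambda>x. a n x *\<^sub>R (g n x - g0 x))" for n
      by (rule L2_bounded_scaleR[OF a(1) b(1) L2_diff[OF L]])
    show "L2 \<Omega> (\<lambda>x. a n x *\<^sub>R g0 x)" for n
      by (rule L2_bounded_scaleR[OF a(1) b(1) L(2)])
    show "L2 \<Omega> (\<lambda>x. a0 x *\<^sub>R g0 x)"
      by (rule L2_bounded_scaleR[OF a(2) b(2) L(2)])
    show "L2 \<Omega> (\<lambda>x. 0 :: 'b)" by (simp add: L2_def)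
  qed
  then show ?thesis by (simp add: scaleR_right_diff_distrib)
qed

section \<open>Test functions in \<open>L2\<close> and approximating sequences for
  \<open>H01\<close>\<close>

lemma test_fun_measurable_on: "test_fun \<Omega> f \<Longrightarrow> f \<in> borel_measurable (lebesgue_on \<Omega>)"
  by (intro measurable_restrict_space1 measurable_completion) (simp add: test_fun_measurable)

lemma test_fun_L2:
  assumes "test_fun \<Omega> f" "open \<Omega>"
  shows "L2 \<Omega> f"
proof -
  have "test_fun \<Omega> (\<lambda>x. f x * f x)"
    by (rule test_fun_mult[OF test_funD(1)[OF assms(1)] assms(1)])
  from test_fun_integrable_on[OF this assms(2)] test_fun_measurable_on[OF assms(1)]
  show ?thesis by (simp add: L2_def power2_eq_square)
qed

lemma test_fun_cgrad_L2:
  assumes "test_fun \<Omega> f" "open \<Omega>"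
  shows "L2 \<Omega> (cgrad f)"
proof -
  have i: "L2 \<Omega> (pderiv_dir f i)" if "i \<in> Basis" for i
    by (rule test_fun_L2[OF test_fun_pderiv[OF assms(1) that] assms(2)])
  have m: "cgrad f \<in> borel_measurable (lebesgue_on \<Omega>)"
    unfolding cgrad_def
    by (intro borel_measurable_sum borel_measurable_scaleR L2_measurable[OF i] borel_measurable_const)
  have "(norm (cgrad f x))\<^sup>2 = (\<Sum>i\<in>Basis. (norm (pderiv_dir f i x))\<^sup>2)" for x
    unfolding power2_norm_eq_inner
    by (subst euclidean_inner) (simp add: cgrad_inner_Basis power2_eq_square)
  then have "integrable (lebesgue_on \<Omega>) (\<lambda>x. (norm (cgrad f x))\<^sup>2)"
    using L2_integrable[OF i] by simp
  with m show ?thesis by (simp add: L2_def)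
qed

lemma H1_dist2_tendsto_iff:
  "(\<lambda>n. H1_dist2 \<Omega> (f n) (g n) f0 g0) \<longlonglongrightarrow> 0 \<longleftrightarrow>
    (\<lambda>n. \<integral>x. (f n x - f0 x)\<^sup>2 \<partial>lebesgue_on \<Omega>) \<longlonglongrightarrow> 0 \<and>
    (\<lambda>n. \<integral>x. (norm (g n x - g0 x))\<^sup>2 \<partial>lebesgue_on \<Omega>) \<longlonglongrightarrow> 0" (is "?L \<longleftrightarrow> ?A \<longlonglongrightarrow> 0 \<and> ?B \<longlonglongrightarrow> 0")
proof
  assume L: ?L
  have "?A \<longlonglongrightarrow> 0"
    by (rule tendsto_sandwich[OF _ _ tendsto_const L]) (auto simp: H1_dist2_def)
  moreover have "?B \<longlonglongrightarrow> 0"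
    by (rule tendsto_sandwich[OF _ _ tendsto_const L]) (auto simp: H1_dist2_def)
  ultimately show "?A \<longlonglongrightarrow> 0 \<and> ?B \<longlonglongrightarrow> 0" by blast
next
  assume "?A \<longlonglongrightarrow> 0 \<and> ?B \<longlonglongrightarrow> 0"
  then show ?L unfolding H1_dist2_def using tendsto_add[of ?A 0 sequentially ?B 0] by simp
qed

text \<open>Both sides of the integration by parts formula are continuous in the L^2 norm for a
  fixed test function, so the weak gradient condition is inherited from the approximating
  sequence.\<close>

lemma H01I:
  assumes \<Omega>: "open \<Omega>" and L: "L2 \<Omega> z" "L2 \<Omega> h"
    and t: "\<And>n. test_fun \<Omega> (\<phi> n)"
    and lim: "(\<lambda>n. \<integral>x. (\<phi> n x - z x)\<^sup>2 \<partial>lebesgue_on \<Omega>) \<longlonglongrightarrow> 0"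
      "(\<lambda>n. \<integral>x. (norm (cgrad (\<phi> n) x - h x))\<^sup>2 \<partial>lebesgue_on \<Omega>) \<longlonglongrightarrow> 0"
  shows "H01 \<Omega> z h"
proof -
  have "weak_grad \<Omega> z h"
    unfolding weak_grad_def
  proof (intro allI impI)
    fix \<psi> and i :: 'a
    assume "test_fun \<Omega> \<psi> \<and> i \<in> Basis"
    then have psi: "test_fun \<Omega> \<psi>" and i: "i \<in> Basis" by auto
    have L3: "L2 \<Omega> \<psi>" "L2 \<Omega> (pderiv_dir \<psi> i)"
      by (intro test_fun_L2 psi \<Omega> test_fun_pderiv i)+
    have L1: "L2 \<Omega> (\<phi> n)" "L2 \<Omega> (cgrad (\<phi> n))" for n
      by (intro test_fun_L2 test_fun_cgrad_L2 t \<Omega>)+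
    have iz: "integrable (lebesgue_on \<Omega>) (\<lambda>x. z x * pderiv_dir \<psi> i x)"
      and ip: "\<And>n. integrable (lebesgue_on \<Omega>) (\<lambda>x. \<phi> n x * pderiv_dir \<psi> i x)"
      and ih: "integrable (lebesgue_on \<Omega>) (\<lambda>x. (h x \<bullet> i) * \<psi> x)"
      and ig: "\<And>n. integrable (lebesgue_on \<Omega>) (\<lambda>x. (cgrad (\<phi> n) x \<bullet> i) * \<psi> x)"
      by (intro L2_mult_integrable L2_inner_left L L1 L3)+
    have A: "(\<lambda>n. \<integral>x. (\<phi> n x - z x) * pderiv_dir \<psi> i x \<partial>lebesgue_on \<Omega>) \<longlonglongrightarrow> 0"
      by (rule L2_integral_mult_tendsto_0[OF L2_diff[OF L1(1) L(1)] L3(2) lim(1)])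
    have B: "(\<lambda>n. \<integral>x. ((cgrad (\<phi> n) x - h x) \<bullet> i) * \<psi> x \<partial>lebesgue_on \<Omega>) \<longlonglongrightarrow> 0"
    proof (rule L2_integral_mult_tendsto_0[OF L2_inner_left[OF L2_diff[OF L1(2) L(2)]] L3(1)])
      show "(\<lambda>n. \<integral>x. ((cgrad (\<phi> n) x - h x) \<bullet> i)\<^sup>2 \<partial>lebesgue_on \<Omega>) \<longlonglongrightarrow> 0"
      proof (rule tendsto_sandwich[OF _ _ tendsto_const lim(2)])
        have "((cgrad (\<phi> n) x - h x) \<bullet> i)\<^sup>2 \<le> (norm (cgrad (\<phi> n) x - h x))\<^sup>2" for n x
          using power_mono[OF Basis_le_norm[OF i, of "cgrad (\<phi> n) x - h x"], of 2] by simp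
        then have "(\<integral>x. ((cgrad (\<phi> n) x - h x) \<bullet> i)\<^sup>2 \<partial>lebesgue_on \<Omega>)
            \<le> (\<integral>x. (norm (cgrad (\<phi> n) x - h x))\<^sup>2 \<partial>lebesgue_on \<Omega>)" for n
          using L2_integrable[OF L2_diff[OF L1(2)[of n] L(2)]]
            L2_integrable[OF L2_inner_left[OF L2_diff[OF L1(2)[of n] L(2)], of i]]
          by (intro integral_mono) auto
        then show "\<forall>\<^sub>F n in sequentially. (\<integral>x. ((cgrad (\<phi> n) x - h x) \<bullet> i)\<^sup>2 \<partial>lebesgue_on \<Omega>)
            \<le> (\<integral>x. (norm (cgrad (\<phi> n) x - h x))\<^sup>2 \<partial>lebesgue_on \<Omega>)" by simp
      qed simp
    qed
    \<comment> \<open>The contributions of \<open>\<phi> n\<close> cancel, so the sum of the two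
      error integrals does not depend on \<open>n\<close>; being a constant sequence with limit 0,
      it is 0.\<close>
    have eqn: "(\<integral>x. (\<phi> n x - z x) * pderiv_dir \<psi> i x \<partial>lebesgue_on \<Omega>)
        + (\<integral>x. ((cgrad (\<phi> n) x - h x) \<bullet> i) * \<psi> x \<partial>lebesgue_on \<Omega>)
      = - ((\<integral>x. z x * pderiv_dir \<psi> i x \<partial>lebesgue_on \<Omega>) + (\<integral>x. (h x \<bullet> i) * \<psi> x \<partial>lebesgue_on \<Omega>))" for n
    proof -
      have "(\<integral>x. \<phi> n x * pderiv_dir \<psi> i x \<partial>lebesgue_on \<Omega>) = - (\<integral>x. (cgrad (\<phi> n) x \<bullet> i) * \<psi> x \<partial>lebesgue_on \<Omega>)"
        using test_fun_weak_grad[OF t[of n] \<Omega>] psi i unfolding weak_grad_def by blast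
      then show ?thesis
        by (simp add: left_diff_distrib inner_diff_left iz ip ih ig)
    qed
    have "- ((\<integral>x. z x * pderiv_dir \<psi> i x \<partial>lebesgue_on \<Omega>) + (\<integral>x. (h x \<bullet> i) * \<psi> x \<partial>lebesgue_on \<Omega>)) = 0"
      using tendsto_add[OF A B] unfolding eqn by (simp add: LIMSEQ_const_iff)
    then show "integrable (lebesgue_on \<Omega>) (\<lambda>x. z x * pderiv_dir \<psi> i x)
      \<and> integrable (lebesgue_on \<Omega>) (\<lambda>x. (h x \<bullet> i) * \<psi> x)
      \<and> (\<integral>x. z x * pderiv_dir \<psi> i x \<partial>lebesgue_on \<Omega>) = - (\<integral>x. (h x \<bullet> i) * \<psi> x \<partial>lebesgue_on \<Omega>)"
      using iz ih by simp
  qed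
  moreover have "(\<lambda>n. H1_dist2 \<Omega> (\<phi> n) (cgrad (\<phi> n)) z h) \<longlonglongrightarrow> 0"
    using lim by (simp add: H1_dist2_tendsto_iff)
  ultimately show ?thesis using L t unfolding H01_def by blast
qed

lemma H01E:
  assumes "H01 \<Omega> u g"
  obtains \<phi> where "\<And>n. test_fun \<Omega> (\<phi> n)"
    "(\<lambda>n. \<integral>x. (\<phi> n x - u x)\<^sup>2 \<partial>lebesgue_on \<Omega>) \<longlonglongrightarrow> 0"
    "(\<lambda>n. \<integral>x. (norm (cgrad (\<phi> n) x - g x))\<^sup>2 \<partial>lebesgue_on \<Omega>) \<longlonglongrightarrow> 0"
proof -
  obtain \<phi> where 1: "\<And>n. test_fun \<Omega> (\<phi> n)"
    and 2: "(\<lambda>n. H1_dist2 \<Omega> (\<phi> n) (cgrad (\<phi> n)) u g) \<longlonglongrightarrow> 0"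
    using assms unfolding H01_def by blast
  show ?thesis
    using 2[unfolded H1_dist2_tendsto_iff] by (intro that[OF 1]) auto
qed

lemma H01_L2: "H01 \<Omega> u g \<Longrightarrow> L2 \<Omega> u" "H01 \<Omega> u g \<Longrightarrow> L2 \<Omega> g"
  by (auto simp: H01_def)

lemma test_fun_cmult: "test_fun \<Omega> f \<Longrightarrow> test_fun \<Omega> (\<lambda>x. c * f x)"
  by (rule test_fun_mult[OF smooth_fun_const])

text \<open>Needed because the norm bound on \<open>w\<close> speaks of single members of
  \<open>H01\<close>, while the convergence proof has to apply it to \<open>z k - v\<close>.\<close>

lemma H01_diff:
  assumes \<Omega>: "open \<Omega>" and u: "H01 \<Omega> u g" and v: "H01 \<Omega> v h"
  shows "H01 \<Omega> (\<lambda>x. u x - v x) (\<lambda>x. g x - h x)"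
proof -
  obtain \<phi> where p: "\<And>n. test_fun \<Omega> (\<phi> n)"
    "(\<lambda>n. \<integral>x. (\<phi> n x - u x)\<^sup>2 \<partial>lebesgue_on \<Omega>) \<longlonglongrightarrow> 0"
    "(\<lambda>n. \<integral>x. (norm (cgrad (\<phi> n) x - g x))\<^sup>2 \<partial>lebesgue_on \<Omega>) \<longlonglongrightarrow> 0"
    using u by (rule H01E) blast
  obtain \<psi> where q: "\<And>n. test_fun \<Omega> (\<psi> n)"
    "(\<lambda>n. \<integral>x. (\<psi> n x - v x)\<^sup>2 \<partial>lebesgue_on \<Omega>) \<longlonglongrightarrow> 0"
    "(\<lambda>n. \<integral>x. (norm (cgrad (\<psi> n) x - h x))\<^sup>2 \<partial>lebesgue_on \<Omega>) \<longlonglongrightarrow> 0"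
    using v by (rule H01E) blast
  have t: "test_fun \<Omega> (\<lambda>x. \<phi> n x + (- 1) * \<psi> n x)" for n
    by (intro test_fun_add test_fun_cmult p q)
  have g: "cgrad (\<lambda>x. \<phi> n x + (- 1) * \<psi> n x) x = cgrad (\<phi> n) x + (- cgrad (\<psi> n) x)" for n x
    by (rule cgrad_eqI)
      (auto intro!: derivative_eq_intros test_funD(4)[OF p(1)] test_funD(4)[OF q(1)] simp: inner_diff_left)
  note L = H01_L2[OF u] H01_L2[OF v]
  have neg: "L2 \<Omega> (\<lambda>x. - f x)" if "L2 \<Omega> f" for f :: "'a \<Rightarrow> 'c::euclidean_space"
    using L2_scaleR[OF that, of "-1"] by simp
  \<comment> \<open>Differences are treated as sums with a negated term; this turns the distance
    between negatives back into the distance known to converge.\<close>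
  have swap: "norm (- a - - b) = norm (a - b)" for a b :: "'c::euclidean_space"
    by (metis minus_diff_minus norm_minus_cancel)
  show ?thesis
  proof (rule H01I[OF \<Omega> L2_diff[OF L(1,3)] L2_diff[OF L(2,4)] t])
    have "(\<lambda>n. \<integral>x. (norm ((\<phi> n x + - \<psi> n x) - (u x + - v x)))\<^sup>2 \<partial>lebesgue_on \<Omega>) \<longlonglongrightarrow> 0"
      by (rule L2_tendsto_add, unfold swap)
        (simp_all add: test_fun_L2[OF p(1) \<Omega>] neg[OF test_fun_L2[OF q(1) \<Omega>]] L neg[OF L(3)] p(2) q(2))
    then show "(\<lambda>n. \<integral>x. (\<phi> n x + (- 1) * \<psi> n x - (u x - v x))\<^sup>2 \<partial>lebesgue_on \<Omega>) \<longlonglongrightarrow> 0"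
      by simp
    have "(\<lambda>n. \<integral>x. (norm ((cgrad (\<phi> n) x + - cgrad (\<psi> n) x) - (g x + - h x)))\<^sup>2 \<partial>lebesgue_on \<Omega>) \<longlonglongrightarrow> 0"
      by (rule L2_tendsto_add, unfold swap)
        (simp_all add: test_fun_cgrad_L2[OF p(1) \<Omega>] neg[OF test_fun_cgrad_L2[OF q(1) \<Omega>]] L neg[OF L(4)] p(3) q(3))
    then show "(\<lambda>n. \<integral>x. (norm (cgrad (\<lambda>x. \<phi> n x + (- 1) * \<psi> n x) x - (g x - h x)))\<^sup>2 \<partial>lebesgue_on \<Omega>) \<longlonglongrightarrow> 0"
      unfolding g by simp
  qed
qed

subsection \<open>Truncation and the product rule in \<open>H\<^sub>0\<^sup>1\<close>\<close>

text \<open>Squaring removes the kink of the positive part: at 0 the difference quotient is at most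
  \<open>\<bar>h\<bar>\<close> in absolute value. It is the building block of both the truncation
  and the cut-off.\<close>

lemma has_real_derivative_pos_part_power2:
  "((\<lambda>t::real. (max 0 t)\<^sup>2) has_real_derivative 2 * max 0 t) (at t)"
proof -
  consider "t < 0" | "t > 0" | "t = 0" by linarith
  then show ?thesis
  proof cases
    case 1
    have "((\<lambda>t. (max 0 t)\<^sup>2) has_real_derivative 0) (at t)"
      by (rule has_field_derivative_transform_within_open[of "\<lambda>_. 0" _ _ "{..<0}"]) (use 1 in auto)
    then show ?thesis using 1 by simp
  next
    case 2
    have "((\<lambda>t. (max 0 t)\<^sup>2) has_real_derivative 2 * t) (at t)"
    proof (rule has_field_derivative_transform_within_open[of "\<lambda>t. t\<^sup>2"])
      show "((\<lambda>t. t\<^sup>2) has_real_derivative 2 * t) (at t)"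
        by (auto intro!: derivative_eq_intros)
    qed (use 2 in \<open>auto intro: open_greaterThan[of 0] simp: max_def\<close>)
    then show ?thesis using 2 by simp
  next
    case 3
    have "((\<lambda>h::real. ((max 0 h)\<^sup>2) / h) \<longlongrightarrow> 0) (at 0)"
    proof (rule Lim_null_comparison)
      show "((\<lambda>h::real. \<bar>h\<bar>) \<longlongrightarrow> 0) (at 0)"
        using tendsto_rabs_zero[OF tendsto_ident_at, of UNIV] by simp
      have "norm ((max 0 h)\<^sup>2 / h) \<le> \<bar>h\<bar>" for h :: real
        by (cases "h \<le> 0") (auto simp: power2_eq_square max_def)
      then show "\<forall>\<^sub>F h in at 0. norm ((max 0 h)\<^sup>2 / h) \<le> \<bar>h\<bar>" for h :: real by simp
    qed
    then show ?thesis unfolding 3 DERIV_def by simp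
  qed
qed

text \<open>The \<open>C\<^sup>1\<close> truncation whose derivative is 1 on \<open>[-M, M]\<close>, vanishes outside \<open>[-M-1, M+1]\<close> and is
  linear in between.\<close>
definition trunc :: "real \<Rightarrow> real \<Rightarrow> real" where
  "trunc M t = t - (max 0 (t - M))\<^sup>2 / 2 + (max 0 (t - (M + 1)))\<^sup>2 / 2
     + (max 0 (- t - M))\<^sup>2 / 2 - (max 0 (- t - (M + 1)))\<^sup>2 / 2"

definition trunc' :: "real \<Rightarrow> real \<Rightarrow> real" where
  "trunc' M t = 1 - max 0 (t - M) + max 0 (t - (M + 1)) - max 0 (- t - M) + max 0 (- t - (M + 1))"

lemma has_real_derivative_trunc: "(trunc M has_real_derivative trunc' M t) (at t)"
proof -
  have c: "((\<lambda>t. (max 0 (t - b))\<^sup>2 / 2) has_real_derivative max 0 (t - b)) (at t)" for b t :: real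
  proof -
    have "((\<lambda>t. t - b) has_real_derivative 1) (at t)"
      by (auto intro!: derivative_eq_intros)
    from DERIV_cdivide[OF DERIV_chain2[OF has_real_derivative_pos_part_power2 this], of 2]
    show ?thesis by simp
  qed
  have c': "((\<lambda>t. (max 0 (- t - b))\<^sup>2 / 2) has_real_derivative - max 0 (- t - b)) (at t)" for b t :: real
  proof -
    have "((\<lambda>t. - t - b) has_real_derivative - 1) (at t)"
      by (auto intro!: derivative_eq_intros)
    from DERIV_cdivide[OF DERIV_chain2[OF has_real_derivative_pos_part_power2 this], of 2]
    show ?thesis by simp
  qed
  have "(trunc M has_real_derivative (1 - max 0 (t - M) + max 0 (t - (M + 1))
      + - max 0 (- t - M) - - max 0 (- t - (M + 1)))) (at t)"
    unfolding trunc_def by (intro DERIV_diff DERIV_add c c' DERIV_ident)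
  then show ?thesis
    by (simp add: trunc'_def)
qed

lemma continuous_on_trunc': "continuous_on UNIV (trunc' M)"
  unfolding trunc'_def by (intro continuous_intros)

lemma trunc'_bound: "M \<ge> 0 \<Longrightarrow> \<bar>trunc' M t\<bar> \<le> 1"
  by (auto simp: trunc'_def max_def)

lemma trunc_ident: "\<bar>t\<bar> \<le> M \<Longrightarrow> trunc M t = t"
  and trunc'_ident: "\<bar>t\<bar> \<le> M \<Longrightarrow> trunc' M t = 1"
  by (auto simp: trunc'_def trunc_def max_def)

text \<open>The function is odd, so \<open>t \<ge> 0\<close> suffices, and beyond
  \<open>M + 1\<close> it is constantly \<open>M + 1 / 2\<close>; the stated bound is a convenient
  rounding.\<close>

lemma trunc_bound:
  assumes "M \<ge> 0"
  shows "\<bar>trunc M t\<bar> \<le> M + 1"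
proof -
  have pos: "\<bar>trunc M t\<bar> \<le> M + 1" if "t \<ge> 0" for t
  proof -
    consider "t \<le> M" | "M < t" "t \<le> M + 1" | "t > M + 1" by linarith
    then show ?thesis
    proof cases
      case 1
      then show ?thesis using trunc_ident[of t M] that by simp
    next
      case 2
      then have eq: "trunc M t = t - (t - M)\<^sup>2 / 2"
        using assms by (simp add: trunc_def max_def)
      have "(t - M)\<^sup>2 \<le> 1" using 2 by (simp add: power_le_one)
      then show ?thesis using 2 assms zero_le_power2[of "t - M"] unfolding eq by linarith
    next
      case 3
      then have "trunc M t = t - (t - M)\<^sup>2 / 2 + (t - (M + 1))\<^sup>2 / 2"
        using assms by (simp add: trunc_def max_def)
      also have "\<dots> = M + 1 / 2" by (simp add: power2_eq_square field_simps)
      finally show ?thesis using assms by simp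
    qed
  qed
  have "trunc M (- t) = - trunc M t"
    by (simp add: trunc_def)
  then show ?thesis using pos[of t] pos[of "- t"] by (cases "t \<ge> 0") auto
qed

lemma trunc_0: "M \<ge> 0 \<Longrightarrow> trunc M 0 = 0"
  by (simp add: trunc_ident)

text \<open>Approximate \<open>H u * v\<close> by \<open>P\<^sub>n (U\<^sub>n) * Q\<^sub>n (V\<^sub>n)\<close>, where \<open>U\<^sub>n\<close>, \<open>V\<^sub>n\<close> are test functions
  converging to \<open>u\<close>, \<open>v\<close> in \<open>H\<^sup>1\<close> and almost everywhere, and \<open>P\<^sub>n\<close>, \<open>Q\<^sub>n\<close> are polynomials that are
  \<open>C\<^sup>1\<close>-close, on the ranges of \<open>U\<^sub>n\<close> and \<open>V\<^sub>n\<close>, to \<open>H\<close> and to a \<open>C\<^sup>1\<close> truncation which is the identity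
  on the essential range of \<open>v\<close>. The truncation bounds the coefficient of the gradient of \<open>U\<^sub>n\<close>.\<close>
lemma H01_compose_mult:
  fixes H H' :: "real \<Rightarrow> real" and \<Omega> :: "'a::euclidean_space set"
  assumes \<Omega>: "open \<Omega>" "bounded \<Omega>"
    and H: "\<And>s. (H has_real_derivative H' s) (at s)" "continuous_on UNIV H'"
    and Hb: "\<And>s. \<bar>H s\<bar> \<le> C" "\<And>s. \<bar>H' s\<bar> \<le> C"
    and u: "H01 \<Omega> u Du" and v: "H01 \<Omega> v Dv" "Linfty \<Omega> v"
  shows "H01 \<Omega> (\<lambda>x. H (u x) * v x) (\<lambda>x. H (u x) *\<^sub>R Dv x + (H' (u x) * v x) *\<^sub>R Du x)"
proof -
  let ?L = "lebesgue_on \<Omega>"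
  obtain M0 where "AE x in ?L. \<bar>v x\<bar> \<le> M0"
    using v(2) by (auto simp: Linfty_def)
  then have vM: "AE x in ?L. \<bar>v x\<bar> \<le> max 0 M0"
    by eventually_elim simp
  \<comment> \<open>On a null domain an essential bound may be negative, whereas the truncation
    needs \<open>M \<ge> 0\<close>.\<close>
  define M where "M = max 0 M0"
  have M: "M \<ge> 0" and vM: "AE x in ?L. \<bar>v x\<bar> \<le> M"
    using vM by (auto simp: M_def)
  have C: "C \<ge> 0" using Hb(1)[of 0] by linarith
  note L = H01_L2[OF u] H01_L2[OF v(1)]
  note [measurable] = L2_measurable[OF L(1)] L2_measurable[OF L(3)]
  obtain \<phi> where p: "\<And>n. test_fun \<Omega> (\<phi> n)"
    "(\<lambda>n. \<integral>x. (\<phi> n x - u x)\<^sup>2 \<partial>?L) \<longlonglongrightarrow> 0"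
    "(\<lambda>n. \<integral>x. (norm (cgrad (\<phi> n) x - Du x))\<^sup>2 \<partial>?L) \<longlonglongrightarrow> 0"
    using u by (rule H01E) blast
  obtain \<psi> where q: "\<And>n. test_fun \<Omega> (\<psi> n)"
    "(\<lambda>n. \<integral>x. (\<psi> n x - v x)\<^sup>2 \<partial>?L) \<longlonglongrightarrow> 0"
    "(\<lambda>n. \<integral>x. (norm (cgrad (\<psi> n) x - Dv x))\<^sup>2 \<partial>?L) \<longlonglongrightarrow> 0"
    using v(1) by (rule H01E) blast
  \<comment> \<open>Adding both squared errors lets a single subsequence converge a.e. for
    \<open>u\<close> and \<open>v\<close> simultaneously.\<close>
  define d where "d n x = (\<phi> n x - u x)\<^sup>2 + (\<psi> n x - v x)\<^sup>2" for n x
  have i1: "integrable ?L (\<lambda>x. (\<phi> n x - u x)\<^sup>2)" for n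
    using L2_integrable[OF L2_diff[OF test_fun_L2[OF p(1) \<Omega>(1)] L(1)]] by simp
  have i2: "integrable ?L (\<lambda>x. (\<psi> n x - v x)\<^sup>2)" for n
    using L2_integrable[OF L2_diff[OF test_fun_L2[OF q(1) \<Omega>(1)] L(3)]] by simp
  have "\<exists>r::nat\<Rightarrow>nat. strict_mono r \<and> (AE x in ?L. (\<lambda>n. d (r n) x) \<longlonglongrightarrow> 0)"
  proof (rule tendsto_L1_AE_subseq)
    show "integrable ?L (d n)" for n
      unfolding d_def by (intro Bochner_Integration.integrable_add i1 i2)
    have "(\<lambda>n. (\<integral>x. (\<phi> n x - u x)\<^sup>2 \<partial>?L) + (\<integral>x. (\<psi> n x - v x)\<^sup>2 \<partial>?L)) \<longlonglongrightarrow> 0"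
      using tendsto_add[OF p(2) q(2)] by simp
    moreover have "(\<integral>x. norm (d n x) \<partial>?L) = (\<integral>x. (\<phi> n x - u x)\<^sup>2 \<partial>?L) + (\<integral>x. (\<psi> n x - v x)\<^sup>2 \<partial>?L)" for n
      using i1 i2 by (simp add: d_def)
    ultimately show "(\<lambda>n. \<integral>x. norm (d n x) \<partial>?L) \<longlonglongrightarrow> 0" by simp
  qed
  then obtain r :: "nat \<Rightarrow> nat" where r: "strict_mono r" "AE x in ?L. (\<lambda>n. d (r n) x) \<longlonglongrightarrow> 0"
    by blast
  define U where "U n = \<phi> (r n)" for n
  define V where "V n = \<psi> (r n)" for n
  have U: "\<And>n. test_fun \<Omega> (U n)" and V: "\<And>n. test_fun \<Omega> (V n)"
    using p q by (auto simp: U_def V_def)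
  have gU: "(\<lambda>n. \<integral>x. (norm (cgrad (U n) x - Du x))\<^sup>2 \<partial>?L) \<longlonglongrightarrow> 0"
    using LIMSEQ_subseq_LIMSEQ[OF p(3) r(1)] by (simp add: U_def comp_def)
  have gV: "(\<lambda>n. \<integral>x. (norm (cgrad (V n) x - Dv x))\<^sup>2 \<partial>?L) \<longlonglongrightarrow> 0"
    using LIMSEQ_subseq_LIMSEQ[OF q(3) r(1)] by (simp add: V_def comp_def)
  have sq0: "f \<longlonglongrightarrow> c" if "(\<lambda>n. (f n - c)\<^sup>2 + g n) \<longlonglongrightarrow> 0" "\<And>n. g n \<ge> 0" for f g and c :: real
  proof -
    have "(\<lambda>n. (f n - c)\<^sup>2) \<longlonglongrightarrow> 0"
      by (rule tendsto_sandwich[OF _ _ tendsto_const that(1)]) (use that(2) in auto)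
    then have "(\<lambda>n. f n - c) \<longlonglongrightarrow> 0"
      by (simp add: power_tendsto_0_iff)
    then show ?thesis by (rule LIM_zero_cancel)
  qed
  have UV: "AE x in ?L. (\<lambda>n. U n x) \<longlonglongrightarrow> u x \<and> (\<lambda>n. V n x) \<longlonglongrightarrow> v x"
    using r(2)
  proof eventually_elim
    case (elim x)
    then show ?case
      unfolding U_def V_def d_def
      using sq0[of "\<lambda>n. \<phi> (r n) x" "u x" "\<lambda>n. (\<psi> (r n) x - v x)\<^sup>2"]
        sq0[of "\<lambda>n. \<psi> (r n) x" "v x" "\<lambda>n. (\<phi> (r n) x - u x)\<^sup>2"]
      by (simp add: add.commute)
  qed
  have "\<exists>B>0. \<forall>x. \<bar>U n x\<bar> \<le> B" for n using test_fun_bounded[OF U[of n]] by metis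
  then obtain BU where BU: "\<And>n. BU n > 0" "\<And>n x. \<bar>U n x\<bar> \<le> BU n" by metis
  have "\<exists>B>0. \<forall>x. \<bar>V n x\<bar> \<le> B" for n using test_fun_bounded[OF V[of n]] by metis
  then obtain BV where BV: "\<And>n. BV n > 0" "\<And>n x. \<bar>V n x\<bar> \<le> BV n" by metis
  define e where "e n = 1 / real (Suc n)" for n
  have e: "e n > 0" "e n \<le> 1" for n by (auto simp: e_def)
  have e0: "e \<longlonglongrightarrow> 0" unfolding e_def by (rule LIMSEQ_Suc[OF lim_1_over_n])
  \<comment> \<open>Packaged as one predicate so that polynomials for all \<open>n\<close> can be
    chosen at once, each on the range of its own test function.\<close>
  define A where "A F F' R n p p' \<longleftrightarrow> real_polynomial_function p \<and> (\<forall>s. (p has_real_derivative p' s) (at s)) \<and>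
      continuous_on UNIV p' \<and> p 0 = F 0 \<and> (\<forall>s. \<bar>s\<bar> \<le> R \<longrightarrow> \<bar>p s - F s\<bar> \<le> e n) \<and>
      (\<forall>s. \<bar>s\<bar> \<le> R \<longrightarrow> \<bar>p' s - F' s\<bar> \<le> e n)"
    for F F' :: "real \<Rightarrow> real" and R n p p'
  have ex: "\<exists>p p'. A F F' R n p p'"
    if F: "\<And>s. (F has_real_derivative F' s) (at s)" "continuous_on UNIV F'" and R: "R > 0"
    for F F' R n
  proof -
    have "R \<ge> 0" using R by simp
    from C1_polynomial_approx[OF F this e(1)[of n]] show ?thesis unfolding A_def by metis
  qed
  have "\<forall>n. \<exists>p p'. A H H' (BU n) n p p'"
    by (intro allI ex[OF H BU(1)])
  then obtain P P' where "\<And>n. A H H' (BU n) n (P n) (P' n)" by metis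
  then have P: "\<And>n. real_polynomial_function (P n)"
    "\<And>n s. (P n has_real_derivative P' n s) (at s)" "\<And>n. continuous_on UNIV (P' n)"
    "\<And>n s. \<bar>s\<bar> \<le> BU n \<Longrightarrow> \<bar>P n s - H s\<bar> \<le> e n"
    "\<And>n s. \<bar>s\<bar> \<le> BU n \<Longrightarrow> \<bar>P' n s - H' s\<bar> \<le> e n"
    unfolding A_def by blast+
  have "\<forall>n. \<exists>p p'. A (trunc M) (trunc' M) (BV n) n p p'"
    by (intro allI ex[OF has_real_derivative_trunc continuous_on_trunc' BV(1)])
  then obtain Q Q' where "\<And>n. A (trunc M) (trunc' M) (BV n) n (Q n) (Q' n)" by metis
  then have Q: "\<And>n. real_polynomial_function (Q n)"
    "\<And>n s. (Q n has_real_derivative Q' n s) (at s)" "\<And>n. continuous_on UNIV (Q' n)"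
    "\<And>n. Q n 0 = trunc M 0"
    "\<And>n s. \<bar>s\<bar> \<le> BV n \<Longrightarrow> \<bar>Q n s - trunc M s\<bar> \<le> e n"
    "\<And>n s. \<bar>s\<bar> \<le> BV n \<Longrightarrow> \<bar>Q' n s - trunc' M s\<bar> \<le> e n"
    unfolding A_def by blast+
  have Pd: "\<bar>P n (U n x) - H (U n x)\<bar> \<le> e n" "\<bar>P' n (U n x) - H' (U n x)\<bar> \<le> e n" for n x
    using P(4,5) BU(2) by blast+
  have Qd: "\<bar>Q n (V n x) - trunc M (V n x)\<bar> \<le> e n" "\<bar>Q' n (V n x) - trunc' M (V n x)\<bar> \<le> e n" for n x
    using Q(5,6) BV(2) by blast+
  have Pb: "\<bar>P n (U n x)\<bar> \<le> C + 1" "\<bar>P' n (U n x)\<bar> \<le> C + 1" for n x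
    using Pd[where n=n and x=x] Hb[of "U n x"] e(2)[of n] by linarith+
  have Qb: "\<bar>Q n (V n x)\<bar> \<le> M + 2" "\<bar>Q' n (V n x)\<bar> \<le> M + 2" for n x
    using Qd[where n=n and x=x] trunc_bound[OF M, of "V n x"] trunc'_bound[OF M, of "V n x"] e(2)[of n] M
    by linarith+
  \<comment> \<open>The exact functions are bounded by \<open>C\<close> and \<open>M + 1\<close>,
    and the polynomial errors by 1. \<open>K\<close> thus bounds every coefficient product that
    occurs, approximate or limiting.\<close>
  define K where "K = (C + 1) * (M + 2)"
  have K: "\<bar>a * b\<bar> \<le> K" if "\<bar>a\<bar> \<le> C + 1" "\<bar>b\<bar> \<le> M + 2" for a b
    unfolding K_def abs_mult by (intro mult_mono that) (use C in auto)
  have cont: "continuous_on UNIV f" if "\<And>s. (f has_real_derivative f' s) (at s)" for f f' :: "real \<Rightarrow> real"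
    using that by (meson DERIV_isCont continuous_at_imp_continuous_on)
  have comp_meas: "(\<lambda>x. f (g x)) \<in> borel_measurable ?L"
    if "continuous_on UNIV f" "g \<in> borel_measurable ?L" for f :: "real \<Rightarrow> real" and g
    using borel_measurable_continuous_on[OF that] .
  note mU = test_fun_measurable_on[OF U] and mV = test_fun_measurable_on[OF V]
  note mm = comp_meas[OF cont[OF P(2)] mU] comp_meas[OF P(3) mU] comp_meas[OF cont[OF Q(2)] mV] comp_meas[OF Q(3) mV]
    comp_meas[OF cont[OF H(1)], of u] comp_meas[OF H(2), of u]
  note [measurable] = mm
  \<comment> \<open>Both the function and its argument vary: the uniform error \<open>e n\<close>
    handles the former, continuity of the limit function the latter.\<close>
  have approx: "(\<lambda>n. f n (s n)) \<longlonglongrightarrow> F c"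
    if "\<And>n. \<bar>f n (s n) - F (s n)\<bar> \<le> e n" "continuous_on UNIV F" "s \<longlonglongrightarrow> c"
    for f :: "nat \<Rightarrow> real \<Rightarrow> real" and s F c
  proof -
    have "(\<lambda>n. f n (s n) - F (s n)) \<longlonglongrightarrow> 0"
      by (rule Lim_null_comparison[OF _ e0]) (use that(1) in simp)
    moreover have "(\<lambda>n. F (s n)) \<longlonglongrightarrow> F c"
      using that(2,3) by (metis UNIV_I continuous_on_def continuous_on_tendsto_compose eventually_sequentiallyI)
    ultimately show ?thesis
      using tendsto_add by fastforce
  qed
  have lim: "AE x in ?L. (\<lambda>n. P n (U n x)) \<longlonglongrightarrow> H (u x) \<and> (\<lambda>n. P' n (U n x)) \<longlonglongrightarrow> H' (u x)
      \<and> (\<lambda>n. Q n (V n x)) \<longlonglongrightarrow> v x \<and> (\<lambda>n. Q' n (V n x)) \<longlonglongrightarrow> 1"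
    using UV vM
  proof eventually_elim
    case (elim x)
    then have 1: "(\<lambda>n. U n x) \<longlonglongrightarrow> u x" and 2: "(\<lambda>n. V n x) \<longlonglongrightarrow> v x" and 3: "\<bar>v x\<bar> \<le> M" by auto
    have "(\<lambda>n. P n (U n x)) \<longlonglongrightarrow> H (u x)"
      by (rule approx[where F=H and f=P and s="\<lambda>n. U n x", OF Pd(1) cont[OF H(1)] 1])
    moreover have "(\<lambda>n. P' n (U n x)) \<longlonglongrightarrow> H' (u x)"
      by (rule approx[where F=H' and f=P' and s="\<lambda>n. U n x", OF Pd(2) H(2) 1])
    moreover have "(\<lambda>n. Q n (V n x)) \<longlonglongrightarrow> trunc M (v x)"
      by (rule approx[where F="trunc M" and f=Q and s="\<lambda>n. V n x", OF Qd(1) cont[OF has_real_derivative_trunc] 2])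
    moreover have "(\<lambda>n. Q' n (V n x)) \<longlonglongrightarrow> trunc' M (v x)"
      by (rule approx[where F="trunc' M" and f=Q' and s="\<lambda>n. V n x", OF Qd(2) continuous_on_trunc' 2])
    ultimately show ?case using trunc_ident[OF 3] trunc'_ident[OF 3] by simp
  qed
  have Hb1: "\<bar>H s\<bar> \<le> C + 1" "\<bar>H' s\<bar> \<le> C + 1" for s
    using Hb[of s] by linarith+
  have b1: "AE x in ?L. \<bar>H (u x) * v x\<bar> \<le> K"
    using vM by eventually_elim (rule K[OF Hb1(1)], simp)
  have b2: "AE x in ?L. \<bar>H' (u x) * v x\<bar> \<le> K"
    using vM by eventually_elim (rule K[OF Hb1(2)], simp)
  \<comment> \<open>Read as the product with the coefficient 1, the limit of
    \<open>Q' n (V n x)\<close>.\<close>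
  have b3: "AE x in ?L. \<bar>H (u x)\<bar> \<le> K"
    using K[OF Hb1(1), of 1] M by simp
  \<comment> \<open>Here boundedness of \<Omega> enters: constants are square integrable, so bounded
    a.e. convergent products converge in L^2.\<close>
  have one: "L2 \<Omega> (\<lambda>x. 1 :: real)"
    unfolding L2_def
    using finite_measure.integrable_const[OF finite_measure_lebesgue_on[OF lmeasurable_open[OF \<Omega>(2,1)]]] by simp
  have "L2 \<Omega> (\<lambda>x. (H (u x) * v x) *\<^sub>R (1 :: real))"
    by (rule L2_bounded_scaleR[OF _ b1 one]) simp
  then have Lz: "L2 \<Omega> (\<lambda>x. H (u x) * v x)" by simp
  have Lg1: "L2 \<Omega> (\<lambda>x. H (u x) *\<^sub>R Dv x)"
    by (rule L2_bounded_scaleR[OF _ b3 L(4)]) simp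
  have Lg2: "L2 \<Omega> (\<lambda>x. (H' (u x) * v x) *\<^sub>R Du x)"
    by (rule L2_bounded_scaleR[OF _ b2 L(2)]) simp
  have t: "test_fun \<Omega> (\<lambda>x. P n (U n x) * Q n (V n x))" for n
  proof (rule test_fun_mult)
    show "smooth_fun (\<lambda>x. P n (U n x))"
      by (rule smooth_fun_polynomial_compose[OF P(1) test_funD(1)[OF U]])
    show "test_fun \<Omega> (\<lambda>x. Q n (V n x))"
    proof (rule test_fun_subset[OF _ V])
      show "smooth_fun (\<lambda>x. Q n (V n x))"
        by (rule smooth_fun_polynomial_compose[OF Q(1) test_funD(1)[OF V]])
      \<comment> \<open>\<open>Q n\<close> agrees with the truncation at 0 and so vanishes there;
        this factor gives the product its compact support, since \<open>P n 0\<close> may be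
        nonzero.\<close>
      have "{x. Q n (V n x) \<noteq> 0} \<subseteq> {x. V n x \<noteq> 0}"
        using Q(4)[of n] trunc_0[OF M] by auto
      then show "{x. Q n (V n x) \<noteq> 0} \<subseteq> closure {x. V n x \<noteq> 0}"
        using closure_subset by (rule order_trans)
    qed
  qed
  have grad: "cgrad (\<lambda>x. P n (U n x) * Q n (V n x)) x
      = (P n (U n x) * Q' n (V n x)) *\<^sub>R cgrad (V n) x + (P' n (U n x) * Q n (V n x)) *\<^sub>R cgrad (U n) x" for n x
  proof (rule cgrad_eqI)
    have 1: "((\<lambda>x. P n (U n x)) has_derivative (\<lambda>h. P' n (U n x) * (cgrad (U n) x \<bullet> h))) (at x)"
      by (rule has_derivative_compose[OF test_funD(4)[OF U] has_field_derivative_imp_has_derivative[OF P(2)]])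
    have 2: "((\<lambda>x. Q n (V n x)) has_derivative (\<lambda>h. Q' n (V n x) * (cgrad (V n) x \<bullet> h))) (at x)"
      by (rule has_derivative_compose[OF test_funD(4)[OF V] has_field_derivative_imp_has_derivative[OF Q(2)]])
    show "((\<lambda>x. P n (U n x) * Q n (V n x)) has_derivative
        (\<lambda>h. ((P n (U n x) * Q' n (V n x)) *\<^sub>R cgrad (V n) x + (P' n (U n x) * Q n (V n x)) *\<^sub>R cgrad (U n) x) \<bullet> h)) (at x)"
      by (rule has_derivative_eq_rhs[OF has_derivative_mult[OF 1 2]])
        (auto simp: inner_add_left algebra_simps)
  qed
  have LU: "L2 \<Omega> (cgrad (U n))" and LV: "L2 \<Omega> (cgrad (V n))" for n
    by (intro test_fun_cgrad_L2 U V \<Omega>(1))+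
  show ?thesis
  proof (rule H01I[OF \<Omega>(1) Lz L2_add[OF Lg1 Lg2] t])
    have "(\<lambda>n. \<integral>x. (norm ((P n (U n x) * Q n (V n x)) *\<^sub>R (1::real) - (H (u x) * v x) *\<^sub>R 1))\<^sup>2 \<partial>?L) \<longlonglongrightarrow> 0"
    proof (rule L2_tendsto_bounded_scaleR_const[OF _ _ _ b1 _ one])
      show "AE x in ?L. (\<lambda>n. P n (U n x) * Q n (V n x)) \<longlonglongrightarrow> H (u x) * v x"
        using lim by eventually_elim (auto intro: tendsto_mult)
    qed (use K Pb Qb in auto)
    then show "(\<lambda>n. \<integral>x. (P n (U n x) * Q n (V n x) - H (u x) * v x)\<^sup>2 \<partial>?L) \<longlonglongrightarrow> 0"
      by simp
    have A: "(\<lambda>n. \<integral>x. (norm ((P n (U n x) * Q' n (V n x)) *\<^sub>R cgrad (V n) x - H (u x) *\<^sub>R Dv x))\<^sup>2 \<partial>?L) \<longlonglongrightarrow> 0"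
    proof (rule L2_tendsto_bounded_scaleR[OF _ _ _ b3 _ LV L(4) gV])
      show "AE x in ?L. (\<lambda>n. P n (U n x) * Q' n (V n x)) \<longlonglongrightarrow> H (u x)"
        using lim
      proof eventually_elim
        case (elim x)
        then have "(\<lambda>n. P n (U n x) * Q' n (V n x)) \<longlonglongrightarrow> H (u x) * 1" by (intro tendsto_mult) auto
        then show ?case by simp
      qed
    qed (use K Pb Qb in auto)
    have B: "(\<lambda>n. \<integral>x. (norm ((P' n (U n x) * Q n (V n x)) *\<^sub>R cgrad (U n) x - (H' (u x) * v x) *\<^sub>R Du x))\<^sup>2 \<partial>?L) \<longlonglongrightarrow> 0"
    proof (rule L2_tendsto_bounded_scaleR[OF _ _ _ b2 _ LU L(2) gU])
      show "AE x in ?L. (\<lambda>n. P' n (U n x) * Q n (V n x)) \<longlonglongrightarrow> H' (u x) * v x"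
        using lim by eventually_elim (auto intro: tendsto_mult)
    qed (use K Pb Qb in auto)
    have LA: "L2 \<Omega> (\<lambda>x. (P n (U n x) * Q' n (V n x)) *\<^sub>R cgrad (V n) x)" for n
      by (rule L2_bounded_scaleR[OF _ _ LV, where C=K]) (use K Pb Qb in auto)
    have LB: "L2 \<Omega> (\<lambda>x. (P' n (U n x) * Q n (V n x)) *\<^sub>R cgrad (U n) x)" for n
      by (rule L2_bounded_scaleR[OF _ _ LU, where C=K]) (use K Pb Qb in auto)
    show "(\<lambda>n. \<integral>x. (norm (cgrad (\<lambda>x. P n (U n x) * Q n (V n x)) x
        - (H (u x) *\<^sub>R Dv x + (H' (u x) * v x) *\<^sub>R Du x)))\<^sup>2 \<partial>?L) \<longlonglongrightarrow> 0"
      unfolding grad by (rule L2_tendsto_add[OF LA Lg1 LB Lg2 A B])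
  qed
qed

subsection \<open>The cut-off argument\<close>

text \<open>The squared positive part composed with \<open>1 - s\<^sup>2\<close>, which makes the
  bump C^1. Its nonnegativity preserves the lower bound on \<open>f\<close> after
  multiplication.\<close>

definition cutoff :: "real \<Rightarrow> real" where
  "cutoff s = (max 0 (1 - s\<^sup>2))\<^sup>2"

definition cutoff' :: "real \<Rightarrow> real" where
  "cutoff' s = - 4 * s * max 0 (1 - s\<^sup>2)"

lemma has_real_derivative_cutoff: "(cutoff has_real_derivative cutoff' s) (at s)"
proof -
  have "((\<lambda>s. 1 - s\<^sup>2) has_real_derivative - 2 * s) (at s)"
    by (auto intro!: derivative_eq_intros)
  from DERIV_chain2[OF has_real_derivative_pos_part_power2 this]
  show ?thesis by (simp add: cutoff_def[abs_def] cutoff'_def mult_ac)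
qed

lemma continuous_on_cutoff': "continuous_on UNIV cutoff'"
  unfolding cutoff'_def by (intro continuous_intros)

lemma cutoff_nonneg: "0 \<le> cutoff s" and cutoff_le_1: "cutoff s \<le> 1"
  by (auto simp: cutoff_def power_le_one)

lemma cutoff_eq_0: "\<bar>s\<bar> \<ge> 1 \<Longrightarrow> cutoff s = 0"
  using abs_le_square_iff[of 1 s] by (simp add: cutoff_def)

text \<open>A crude constant; only boundedness matters, since scaling by \<open>k\<close> divides
  the derivative by \<open>k\<close>.\<close>

lemma cutoff'_bound: "\<bar>cutoff' s\<bar> \<le> 4"
proof (cases "\<bar>s\<bar> \<ge> 1")
  case True
  then show ?thesis using abs_le_square_iff[of 1 s] by (simp add: cutoff'_def)
next
  case False
  then have "\<bar>s\<bar> * \<bar>max 0 (1 - s\<^sup>2)\<bar> \<le> 1 * 1"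
    by (intro mult_mono) auto
  then show ?thesis by (simp add: cutoff'_def abs_mult)
qed

lemma cutoff_scaled_tendsto: "(\<lambda>k. cutoff (s / real (Suc k))) \<longlonglongrightarrow> 1"
proof -
  have "isCont cutoff 0" using has_real_derivative_cutoff DERIV_isCont by blast
  moreover have "(\<lambda>k. s / real (Suc k)) \<longlonglongrightarrow> 0"
    using LIMSEQ_Suc[OF lim_const_over_n[of s]] .
  ultimately have "(\<lambda>k. cutoff (s / real (Suc k))) \<longlonglongrightarrow> cutoff 0"
    by (rule isCont_tendsto_compose)
  then show ?thesis by (simp add: cutoff_def)
qed

theorem theorem4p7:
  fixes \<Omega> :: "'a::euclidean_space set"
    and j js :: "'a \<Rightarrow> real \<Rightarrow> 'a \<Rightarrow> real"
    and jxi :: "'a \<Rightarrow> real \<Rightarrow> 'a \<Rightarrow> 'a"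
    and \<alpha> \<beta> :: "real \<Rightarrow> real" and \<alpha>0 :: real
    and w :: "('a \<Rightarrow> real) \<Rightarrow> real"
    and u v \<eta> :: "'a \<Rightarrow> real" and Du Dv :: "'a \<Rightarrow> 'a"
  assumes dim: "DIM('a) \<ge> 3"
    and \<Omega>: "open \<Omega>" "bounded \<Omega>"
    \<comment> \<open>Caratheodory-type regularity of j\<close>
    and j_meas: "\<And>s \<xi>. (\<lambda>x. j x s \<xi>) \<in> borel_measurable (lebesgue_on \<Omega>)"
    and j_C1: "AE x in lebesgue_on \<Omega>. \<forall>s \<xi>.
        ((\<lambda>(s', \<xi>'). j x s' \<xi>') has_derivative
           (\<lambda>(ds, d\<xi>). js x s \<xi> * ds + jxi x s \<xi> \<bullet> d\<xi>)) (at (s, \<xi>))"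
    and js_cont: "AE x in lebesgue_on \<Omega>. continuous_on UNIV (\<lambda>(s, \<xi>). js x s \<xi>)"
    and jxi_cont: "AE x in lebesgue_on \<Omega>. continuous_on UNIV (\<lambda>(s, \<xi>). jxi x s \<xi>)"
    \<comment> \<open>(H1)\<close>
    and H1: "AE x in lebesgue_on \<Omega>. \<forall>s. strictly_convex (\<lambda>\<xi>. j x s \<xi>)"
    \<comment> \<open>(H2)\<close>
    and \<alpha>0: "\<alpha>0 > 0"
    and \<alpha>: "\<forall>t\<ge>0. \<alpha> t > 0" "mono_on {0..} \<alpha>" "continuous_on {0..} \<alpha>"
    and H2: "AE x in lebesgue_on \<Omega>. \<forall>s \<xi>.
        \<alpha>0 * (norm \<xi>)\<^sup>2 \<le> j x s \<xi> \<and> j x s \<xi> \<le> \<alpha> \<bar>s\<bar> * (norm \<xi>)\<^sup>2"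
    \<comment> \<open>(H3)\<close>
    and \<beta>: "\<forall>t\<ge>0. \<beta> t > 0" "mono_on {0..} \<beta>" "continuous_on {0..} \<beta>"
    and H3: "AE x in lebesgue_on \<Omega>. \<forall>s \<xi>. \<bar>js x s \<xi>\<bar> \<le> \<beta> \<bar>s\<bar> * (norm \<xi>)\<^sup>2"
    \<comment> \<open>data\<close>
    and w: "Hminus1 \<Omega> w"
    and u: "H01 \<Omega> u Du"
    and eq: "\<And>z Dz. in_V \<Omega> u z Dz \<Longrightarrow>
        integrable (lebesgue_on \<Omega>) (\<lambda>x. jxi x (u x) (Du x) \<bullet> Dz x)
      \<and> integrable (lebesgue_on \<Omega>) (\<lambda>x. js x (u x) (Du x) * z x)
      \<and> (\<integral>x. jxi x (u x) (Du x) \<bullet> Dz x \<partial>lebesgue_on \<Omega>)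
          + (\<integral>x. js x (u x) (Du x) * z x \<partial>lebesgue_on \<Omega>) = w z"
    and L1u: "integrable (lebesgue_on \<Omega>) (\<lambda>x. jxi x (u x) (Du x) \<bullet> Du x)"
    and v: "H01 \<Omega> v Dv" "Linfty \<Omega> v"
    and \<eta>: "integrable (lebesgue_on \<Omega>) \<eta>"
    and lower: "AE x in lebesgue_on \<Omega>.
        js x (u x) (Du x) * v x + jxi x (u x) (Du x) \<bullet> Dv x \<ge> \<eta> x"
  shows "integrable (lebesgue_on \<Omega>) (\<lambda>x. jxi x (u x) (Du x) \<bullet> Dv x + js x (u x) (Du x) * v x)
    \<and> (\<integral>x. jxi x (u x) (Du x) \<bullet> Dv x + js x (u x) (Du x) * v x \<partial>lebesgue_on \<Omega>) = w v"
proof -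
  let ?L = "lebesgue_on \<Omega>"
  \<comment> \<open>\<open>Suc k\<close> avoids division by zero at \<open>k = 0\<close>.\<close>
  define c where "c k x = cutoff (u x / real (Suc k))" for k x
  define c' where "c' k x = cutoff' (u x / real (Suc k)) / real (Suc k)" for k x
  define z where "z k x = c k x * v x" for k x
  define Dz where "Dz k x = c k x *\<^sub>R Dv x + (c' k x * v x) *\<^sub>R Du x" for k x
  obtain M where vM: "AE x in ?L. \<bar>v x\<bar> \<le> M"
    using v(2) by (auto simp: Linfty_def)
  note L = H01_L2[OF u] H01_L2[OF v(1)]
  note [measurable] = L2_measurable[OF L(1)] L2_measurable[OF L(2)] L2_measurable[OF L(3)] L2_measurable[OF L(4)]
  have cont: "continuous_on UNIV cutoff"
    using has_real_derivative_cutoff by (meson DERIV_isCont continuous_at_imp_continuous_on)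
  have [measurable]: "c k \<in> borel_measurable ?L" "c' k \<in> borel_measurable ?L" for k
    unfolding c_def c'_def
    by (intro borel_measurable_divide borel_measurable_const
        borel_measurable_continuous_on[OF cont] borel_measurable_continuous_on[OF continuous_on_cutoff']; simp)+
  have c: "0 \<le> c k x" "c k x \<le> 1" "\<bar>c k x\<bar> \<le> 1" for k x
    using cutoff_nonneg cutoff_le_1 by (auto simp: c_def)
  have c': "\<bar>c' k x\<bar> \<le> 4 / real (Suc k)" "\<bar>c' k x\<bar> \<le> 4" for k x
  proof -
    show 1: "\<bar>c' k x\<bar> \<le> 4 / real (Suc k)"
      unfolding c'_def abs_divide using cutoff'_bound by (simp add: divide_right_mono)
    have "4 / real (Suc k) \<le> 4" by (simp add: field_simps)
    with 1 show "\<bar>c' k x\<bar> \<le> 4" by linarith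
  qed
  have clim: "(\<lambda>k. c k x) \<longlonglongrightarrow> 1" for x
    unfolding c_def by (rule cutoff_scaled_tendsto)
  have ctend: "(\<lambda>k. c k x * a) \<longlonglongrightarrow> a" for x a
    using tendsto_mult_right[OF clim[of x], of a] by simp
  have cle: "norm (c k x * a) \<le> \<bar>a\<bar>" for k x a
    using mult_right_mono[OF c(3)[of k x] abs_ge_zero[of a]] by (simp add: abs_mult)
  have c'lim: "(\<lambda>k. c' k x) \<longlonglongrightarrow> 0" for x
    by (rule Lim_null_comparison[OF _ LIMSEQ_Suc[OF lim_const_over_n[of 4]]]) (use c'(1) in auto)

  \<comment> \<open>Admissibility of the test functions \<open>z k\<close>\<close>
  have zH: "H01 \<Omega> (z k) (Dz k)" for k
  proof -
    have "((\<lambda>s. cutoff (s / real (Suc k))) has_real_derivative cutoff' (s / real (Suc k)) / real (Suc k)) (at s)" for s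
    proof -
      have "((\<lambda>s. s / real (Suc k)) has_real_derivative 1 / real (Suc k)) (at s)"
        by (intro DERIV_cdivide DERIV_ident)
      from DERIV_chain2[OF has_real_derivative_cutoff this] show ?thesis by simp
    qed
    moreover have "continuous_on UNIV (\<lambda>s. cutoff' (s / real (Suc k)) / real (Suc k))"
      by (intro continuous_intros continuous_on_compose2[OF continuous_on_cutoff']) auto
    \<comment> \<open>The product rule takes one bound for the outer function and its derivative, so
      4 is used for both.\<close>
    moreover have "\<bar>cutoff (s / real (Suc k))\<bar> \<le> 4" for s
      using cutoff_nonneg[of "s / real (Suc k)"] cutoff_le_1[of "s / real (Suc k)"] by linarith
    moreover have "\<bar>cutoff' (s / real (Suc k)) / real (Suc k)\<bar> \<le> 4" for s
    proof -
      have "\<bar>cutoff' (s / real (Suc k)) / real (Suc k)\<bar> \<le> 4 / 1"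
        unfolding abs_divide by (intro frac_le) (use cutoff'_bound in auto)
      then show ?thesis by simp
    qed
    ultimately show ?thesis
      unfolding z_def[abs_def] Dz_def[abs_def] c_def c'_def
      using H01_compose_mult[OF \<Omega> _ _ _ _ u v,
          of "\<lambda>s. cutoff (s / real (Suc k))" "\<lambda>s. cutoff' (s / real (Suc k)) / real (Suc k)" 4]
      by blast
  qed
  have zV: "in_V \<Omega> u (z k) (Dz k)" for k
  proof -
    have "AE x in ?L. \<bar>z k x\<bar> \<le> M"
      using vM
    proof eventually_elim
      case (elim x)
      have "\<bar>c k x\<bar> * \<bar>v x\<bar> \<le> 1 * \<bar>v x\<bar>" using c by (intro mult_right_mono) auto
      with elim show ?case by (simp add: z_def abs_mult)
    qed
    moreover have "z k \<in> borel_measurable ?L" using zH H01_L2(1) L2_measurable by blast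
    \<comment> \<open>A nonzero cut-off factor forces \<open>\<bar>u x\<bar> < real (Suc k)\<close>;
      this puts \<open>z k\<close> in the admissible class.\<close>
    moreover have "z k x \<noteq> 0 \<longrightarrow> \<bar>u x\<bar> \<le> real (Suc k)" for x
      using cutoff_eq_0[of "u x / real (Suc k)"] by (force simp: z_def c_def field_simps)
    ultimately show ?thesis
      using zH unfolding in_V_def Linfty_def by blast
  qed

  \<comment> \<open>The tested equation and its error term\<close>
  define F where "F x = jxi x (u x) (Du x) \<bullet> Du x" for x
  define f where "f x = jxi x (u x) (Du x) \<bullet> Dv x + js x (u x) (Du x) * v x" for x
  have F: "integrable ?L F" using L1u by (simp add: F_def[abs_def])
  note [measurable] = borel_measurable_integrable[OF F] borel_measurable_integrable[OF \<eta>]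
  have S: "integrable ?L (\<lambda>x. c k x * f x + (c' k x * v x) * F x)"
    "(\<integral>x. c k x * f x + (c' k x * v x) * F x \<partial>?L) = w (z k)" for k
  proof -
    note e = eq[OF zV[of k]]
    have *: "jxi x (u x) (Du x) \<bullet> Dz k x + js x (u x) (Du x) * z k x = c k x * f x + (c' k x * v x) * F x" for x
      by (simp add: Dz_def z_def f_def F_def inner_add_right algebra_simps)
    show "integrable ?L (\<lambda>x. c k x * f x + (c' k x * v x) * F x)"
      unfolding *[symmetric] using e by (intro Bochner_Integration.integrable_add) auto
    show "(\<integral>x. c k x * f x + (c' k x * v x) * F x \<partial>?L) = w (z k)"
      unfolding *[symmetric] using e by simp
  qed
  have M0: "AE x in ?L. \<bar>c' k x * v x * F x\<bar> \<le> (4 * M) * \<bar>F x\<bar>" for k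
    using vM
  proof eventually_elim
    case (elim x)
    then have "\<bar>c' k x * v x\<bar> \<le> 4 * M"
      unfolding abs_mult using c'(2)[of k x] by (intro mult_mono) auto
    then show ?case by (simp only: abs_mult[of _ "F x"] mult_right_mono abs_ge_zero)
  qed
  have wint: "integrable ?L (\<lambda>x. (4 * M) * \<bar>F x\<bar>)" using F by simp
  have TF: "integrable ?L (\<lambda>x. c' k x * v x * F x)" for k
    by (rule Bochner_Integration.integrable_bound[OF wint]) (use M0[of k] in \<open>auto elim!: eventually_mono\<close>)
  have TF0: "(\<lambda>k. \<integral>x. c' k x * v x * F x \<partial>?L) \<longlonglongrightarrow> 0"
  proof -
    have "(\<lambda>k. \<integral>x. c' k x * v x * F x \<partial>?L) \<longlonglongrightarrow> (\<integral>x. 0 \<partial>?L)"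
    proof (rule integral_dominated_convergence[OF _ _ wint])
      show "AE x in ?L. (\<lambda>k. c' k x * v x * F x) \<longlonglongrightarrow> 0"
        by (intro AE_I2 tendsto_mult_left_zero c'lim)
      show "AE x in ?L. norm (c' k x * v x * F x) \<le> (4 * M) * \<bar>F x\<bar>" for k
        using M0[of k] by simp
    qed auto
    then show ?thesis by simp
  qed
  \<comment> \<open>Obtained by subtracting the error term from the tested equation, since
    integrability of \<open>f\<close> is still open.\<close>
  have cf: "integrable ?L (\<lambda>x. c k x * f x)" for k
    using Bochner_Integration.integrable_diff[OF S(1)[of k] TF[of k]] by simp
  have cfI: "(\<integral>x. c k x * f x \<partial>?L) = w (z k) - (\<integral>x. c' k x * v x * F x \<partial>?L)" for k
    using S(2)[of k] cf[of k] TF[of k] by simp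

  \<comment> \<open>Convergence of the duality pairing\<close>
  have wz: "(\<lambda>k. w (z k)) \<longlonglongrightarrow> w v"
  proof -
    obtain K where K: "\<And>u g. H01 \<Omega> u g \<Longrightarrow> \<bar>w u\<bar> \<le> K * sqrt (H1_dist2 \<Omega> u g (\<lambda>_. 0) (\<lambda>_. 0))"
      using w unfolding Hminus1_def by blast
    have lin: "w (z k) - w v = w (\<lambda>x. z k x - v x)" for k
    proof -
      have "w (\<lambda>x. 1 * z k x + (- 1) * v x) = 1 * w (z k) + (- 1) * w v"
        using w zH[of k] v(1) unfolding Hminus1_def by blast
      then show ?thesis by simp
    qed
    have "(\<lambda>k. H1_dist2 \<Omega> (z k) (Dz k) v Dv) \<longlonglongrightarrow> 0"
      unfolding H1_dist2_tendsto_iff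
    proof
      have "(\<lambda>k. \<integral>x. (norm (c k x *\<^sub>R v x - 1 *\<^sub>R v x))\<^sup>2 \<partial>?L) \<longlonglongrightarrow> 0"
        by (rule L2_tendsto_bounded_scaleR_const[where C=1]) (use c clim L in auto)
      then show "(\<lambda>k. \<integral>x. (z k x - v x)\<^sup>2 \<partial>?L) \<longlonglongrightarrow> 0" by (simp add: z_def)
      have 1: "(\<lambda>k. \<integral>x. (norm (c k x *\<^sub>R Dv x - 1 *\<^sub>R Dv x))\<^sup>2 \<partial>?L) \<longlonglongrightarrow> 0"
        by (rule L2_tendsto_bounded_scaleR_const[where C=1]) (use c clim L in auto)
      \<comment> \<open>The limiting coefficient 0 has to obey the same bound, and \<open>M\<close>
        is not known to be nonnegative here.\<close>
      have b: "AE x in ?L. \<bar>c' k x * v x\<bar> \<le> max 0 (4 * M)" for k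
        using vM
      proof eventually_elim
        case (elim x)
        then have "\<bar>c' k x * v x\<bar> \<le> 4 * M"
          unfolding abs_mult using c'(2)[of k x] by (intro mult_mono) auto
        then show ?case by simp
      qed
      have 2: "(\<lambda>k. \<integral>x. (norm ((c' k x * v x) *\<^sub>R Du x - 0 *\<^sub>R Du x))\<^sup>2 \<partial>?L) \<longlonglongrightarrow> 0"
      proof (rule L2_tendsto_bounded_scaleR_const[OF _ _ b _ _ L(2)])
        show "AE x in ?L. (\<lambda>k. c' k x * v x) \<longlonglongrightarrow> 0"
          by (intro AE_I2 tendsto_mult_left_zero c'lim)
      qed auto
      have L1: "L2 \<Omega> (\<lambda>x. c k x *\<^sub>R Dv x)" for k
        by (rule L2_bounded_scaleR[where C=1, OF _ _ L(4)]) (use c in auto)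
      have L2: "L2 \<Omega> (\<lambda>x. (c' k x * v x) *\<^sub>R Du x)" for k
        by (rule L2_bounded_scaleR[OF _ b L(2)]) auto
      have "(\<lambda>k. \<integral>x. (norm ((c k x *\<^sub>R Dv x + (c' k x * v x) *\<^sub>R Du x) - (1 *\<^sub>R Dv x + 0 *\<^sub>R Du x)))\<^sup>2 \<partial>?L) \<longlonglongrightarrow> 0"
        by (rule L2_tendsto_add[OF L1 L2_scaleR[OF L(4)] L2 L2_scaleR[OF L(2)] 1 2])
      then show "(\<lambda>k. \<integral>x. (norm (Dz k x - Dv x))\<^sup>2 \<partial>?L) \<longlonglongrightarrow> 0"
        by (simp add: Dz_def)
    qed
    from tendsto_mult_left[OF tendsto_real_sqrt[OF this], of K]
    have "(\<lambda>k. K * sqrt (H1_dist2 \<Omega> (z k) (Dz k) v Dv)) \<longlonglongrightarrow> 0" by simp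
    moreover have "\<forall>\<^sub>F k in sequentially. norm (w (z k) - w v) \<le> K * sqrt (H1_dist2 \<Omega> (z k) (Dz k) v Dv)"
      using K[OF H01_diff[OF \<Omega>(1) zH v(1)]] unfolding lin by (simp add: H1_dist2_def)
    ultimately have "(\<lambda>k. w (z k) - w v) \<longlonglongrightarrow> 0"
      by (rule Lim_null_comparison[rotated])
    then show ?thesis by (rule LIM_zero_cancel)
  qed

  \<comment> \<open>Integrability of \<open>f\<close> and identification of the limit\<close>
  have cflim: "(\<lambda>k. \<integral>x. c k x * f x \<partial>?L) \<longlonglongrightarrow> w v"
    using tendsto_diff[OF wz TF0] unfolding cfI by simp
  \<comment> \<open>Each \<open>c k x * f x\<close> is integrable, hence measurable, and
    \<open>f\<close> is their pointwise limit.\<close>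
  have [measurable]: "f \<in> borel_measurable ?L"
  proof (rule borel_measurable_LIMSEQ_real)
    show "(\<lambda>k. c k x * f x) \<longlonglongrightarrow> f x" for x
      by (rule ctend)
    show "(\<lambda>x. c k x * f x) \<in> borel_measurable ?L" for k
      by (rule borel_measurable_integrable[OF cf])
  qed
  have low: "AE x in ?L. f x \<ge> \<eta> x"
    using lower by (simp add: f_def add.commute)
  have ceta: "integrable ?L (\<lambda>x. c k x * \<eta> x)" "(\<lambda>k. \<integral>x. c k x * \<eta> x \<partial>?L) \<longlonglongrightarrow> (\<integral>x. \<eta> x \<partial>?L)" for k
  proof -
    have *: "AE x in ?L. norm (c k x * \<eta> x) \<le> \<bar>\<eta> x\<bar>" for k
      by (intro AE_I2 cle)
    have **: "AE x in ?L. (\<lambda>k. c k x * \<eta> x) \<longlonglongrightarrow> \<eta> x"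
      by (intro AE_I2 ctend)
    have \<eta>': "integrable ?L (\<lambda>x. \<bar>\<eta> x\<bar>)" using \<eta> by simp
    show "integrable ?L (\<lambda>x. c k x * \<eta> x)" for k
      by (rule integrable_dominated_convergence2[OF _ _ \<eta>' ** *]) auto
    show "(\<lambda>k. \<integral>x. c k x * \<eta> x \<partial>?L) \<longlonglongrightarrow> (\<integral>x. \<eta> x \<partial>?L)"
      by (rule integral_dominated_convergence[OF _ _ \<eta>' ** *]) auto
  qed
  have fin: "(\<integral>\<^sup>+x. ennreal (f x - \<eta> x) \<partial>?L) < \<infinity>"
  proof -
    have "(\<integral>\<^sup>+x. ennreal (f x - \<eta> x) \<partial>?L) = (\<integral>\<^sup>+x. liminf (\<lambda>k. ennreal (c k x * (f x - \<eta> x))) \<partial>?L)"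
    proof (rule nn_integral_cong)
      fix x
      have "(\<lambda>k. c k x * (f x - \<eta> x)) \<longlonglongrightarrow> f x - \<eta> x"
        by (rule ctend)
      then have "(\<lambda>k. ennreal (c k x * (f x - \<eta> x))) \<longlonglongrightarrow> ennreal (f x - \<eta> x)"
        by (rule tendsto_ennrealI)
      then show "ennreal (f x - \<eta> x) = liminf (\<lambda>k. ennreal (c k x * (f x - \<eta> x)))"
        by (simp add: lim_imp_Liminf)
    qed
    \<comment> \<open>Fatou's lemma. Subtracting \<eta> before multiplying by \<open>c k\<close>
      makes the integrand nonnegative a.e.\<close>
    also have "\<dots> \<le> liminf (\<lambda>k. \<integral>\<^sup>+x. ennreal (c k x * (f x - \<eta> x)) \<partial>?L)"
      by (rule nn_integral_liminf) measurable
    also have "(\<lambda>k. \<integral>\<^sup>+x. ennreal (c k x * (f x - \<eta> x)) \<partial>?L)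
        = (\<lambda>k. ennreal ((\<integral>x. c k x * f x \<partial>?L) - (\<integral>x. c k x * \<eta> x \<partial>?L)))"
    proof
      fix k
      \<comment> \<open>\<open>ennreal\<close> sends negative reals to 0, so the sign is needed to
        identify the extended integral with the real one.\<close>
      have "AE x in ?L. 0 \<le> c k x * f x - c k x * \<eta> x"
        using low by eventually_elim (use c(1) in \<open>simp add: mult_left_mono\<close>)
      then have "(\<integral>\<^sup>+x. ennreal (c k x * f x - c k x * \<eta> x) \<partial>?L) = ennreal (\<integral>x. c k x * f x - c k x * \<eta> x \<partial>?L)"
        by (intro nn_integral_eq_integral Bochner_Integration.integrable_diff cf ceta)
      then show "(\<integral>\<^sup>+x. ennreal (c k x * (f x - \<eta> x)) \<partial>?L)
          = ennreal ((\<integral>x. c k x * f x \<partial>?L) - (\<integral>x. c k x * \<eta> x \<partial>?L))"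
        using cf ceta(1) by (simp add: right_diff_distrib)
    qed
    \<comment> \<open>Both integrals converge, so the lower limit is a limit, and it is
      finite.\<close>
    also have "liminf \<dots> = ennreal (w v - (\<integral>x. \<eta> x \<partial>?L))"
      by (intro lim_imp_Liminf tendsto_ennrealI tendsto_diff cflim ceta) simp
    also have "\<dots> < \<infinity>" by simp
    finally show ?thesis .
  qed
  have "integrable ?L (\<lambda>x. f x - \<eta> x)"
  proof (rule integrableI_nonneg)
    show "AE x in ?L. 0 \<le> f x - \<eta> x" using low by simp
  qed (use fin in auto)
  from Bochner_Integration.integrable_add[OF this \<eta>] have f: "integrable ?L f" by simp
  then have f': "integrable ?L (\<lambda>x. \<bar>f x\<bar>)" by simp
  have "(\<lambda>k. \<integral>x. c k x * f x \<partial>?L) \<longlonglongrightarrow> (\<integral>x. f x \<partial>?L)"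
  proof (rule integral_dominated_convergence[OF _ _ f'])
    show "AE x in ?L. norm (c k x * f x) \<le> \<bar>f x\<bar>" for k
      by (intro AE_I2 cle)
    show "AE x in ?L. (\<lambda>k. c k x * f x) \<longlonglongrightarrow> f x"
      by (intro AE_I2 ctend)
  qed auto
  from LIMSEQ_unique[OF this cflim] f show ?thesis
    unfolding f_def by simp
qed

end
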